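(* The Kadison-Singer Problem has a positive solution if and only if the following statement holds: there is a universal constant $D\ge1$ such that for every $n$ and every $T\in B(\ell_2^n)$ with $\|Te_i\|=1$ for all $i=1,2,\dots,n$, there are a natural number $r=r(\|T\|)$, depending only on $\|T\|$, and a partition $\{A_j\}_{j=1}^r$ of $\{1,2,\dots,n\}$ such that for all $j=1,2,\dots,r$ and all scalars $\{a_i\}_{i\in A_j}$ $$\Big\|\sum_{i\in A_j}a_iTe_i\Big\|^2\le D\sum_{i\in A_j}|a_i|^2 .$$
   Context: Kadison-Singer Problem (KS): does every pure state on the (abelian) von Neumann algebra $\mathbb D$ of bounded diagonal operators on $\ell_2$ have a unique extension to a (pure) state on $B(\ell_2)$, the von Neumann algebra of all bounded linear operators on $\ell_2$? A state of a von Neumann algebra $\mathcal R$ is a linear functional $f$ with $f(I)=1$ and $f(T)\ge0$ whenever $T\ge0$; a pure state is an extreme point of the convex set of states. A positive solution to KS means the answer is yes. $\ell_2^n$ is the complex $n$-dimensional Hilbert space with fixed orthonormal basis $\{e_i\}_{i=1}^n$, and $B(\ell_2^n)$ is the space of linear operators on it. *)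

theory Defs
  imports "HOL-Analysis.Analysis"
begin

text \<open>
  The complex Hilbert space \<open>\<ell>\<^sub>2(I)\<close>. Vectors are functions on the whole index type that vanish
  off \<open>I\<close>, so that \<open>\<ell>\<^sub>2\<close> is \<open>ell2 (UNIV :: nat set)\<close> and the \<open>n\<close>-dimensional space, with \<open>n\<close>
  a term rather than a type, is \<open>ell2 {1..n}\<close>.
\<close>

definition ell2 :: "'i set \<Rightarrow> ('i \<Rightarrow> complex) set" where
  "ell2 I = {x. (\<forall>i. i \<notin> I \<longrightarrow> x i = 0) \<and> (\<lambda>i. (cmod (x i))\<^sup>2) summable_on I}"

definition ell2_inner :: "'i set \<Rightarrow> ('i \<Rightarrow> complex) \<Rightarrow> ('i \<Rightarrow> complex) \<Rightarrow> complex" where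
  "ell2_inner I x y = (\<Sum>\<^sub>\<infinity>i\<in>I. x i * cnj (y i))"

definition ell2_norm :: "'i set \<Rightarrow> ('i \<Rightarrow> complex) \<Rightarrow> real" where
  "ell2_norm I x = sqrt (\<Sum>\<^sub>\<infinity>i\<in>I. (cmod (x i))\<^sup>2)"

definition ell2_basis :: "'i \<Rightarrow> 'i \<Rightarrow> complex" where
  "ell2_basis i = (\<lambda>k. if k = i then 1 else 0)"

type_synonym 'i oper = "('i \<Rightarrow> complex) \<Rightarrow> ('i \<Rightarrow> complex)"

text \<open>
  Operators are extensional functions on \<open>ell2 I\<close>, so that two operators that agree on \<open>ell2 I\<close>
  are equal. For finite \<open>I\<close> the boundedness condition holds for every linear map.
\<close>

definition bounded_opers :: "'i set \<Rightarrow> 'i oper set" where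
  "bounded_opers I = {T \<in> ell2 I \<rightarrow>\<^sub>E ell2 I.
     (\<forall>x\<in>ell2 I. \<forall>y\<in>ell2 I. \<forall>a b.
        T (\<lambda>i. a * x i + b * y i) = (\<lambda>i. a * T x i + b * T y i)) \<and>
     (\<exists>K. \<forall>x\<in>ell2 I. ell2_norm I (T x) \<le> K * ell2_norm I x)}"

definition oper_norm :: "'i set \<Rightarrow> 'i oper \<Rightarrow> real" where
  "oper_norm I T = (SUP x\<in>{x \<in> ell2 I. ell2_norm I x \<le> 1}. ell2_norm I (T x))"

definition oper_id :: "'i set \<Rightarrow> 'i oper" where
  "oper_id I = (\<lambda>x\<in>ell2 I. x)"

definition oper_lincomb ::
    "'i set \<Rightarrow> complex \<Rightarrow> 'i oper \<Rightarrow> complex \<Rightarrow> 'i oper \<Rightarrow> 'i oper" where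
  "oper_lincomb I a S b T = (\<lambda>x\<in>ell2 I. \<lambda>i. a * S x i + b * T x i)"

definition positive_oper :: "'i set \<Rightarrow> 'i oper \<Rightarrow> bool" where
  "positive_oper I T \<longleftrightarrow> T \<in> bounded_opers I \<and> (\<forall>x\<in>ell2 I. ell2_inner I (T x) x \<in> \<real>\<^sub>\<ge>\<^sub>0)"

definition diagonal_opers :: "'i set \<Rightarrow> 'i oper set" where
  "diagonal_opers I =
     {T \<in> bounded_opers I. \<exists>d. \<forall>x\<in>ell2 I. T x = (\<lambda>i. d i * x i)}"

text \<open>
  States on a linear space \<open>R\<close> of operators on \<open>ell2 I\<close> that contains the identity. They are
  extensional on \<open>R\<close>, so equality of states is agreement on \<open>R\<close>.
\<close>

definition states :: "'i set \<Rightarrow> 'i oper set \<Rightarrow> ('i oper \<Rightarrow> complex) set" where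
  "states I R = {f \<in> extensional R.
     (\<forall>S\<in>R. \<forall>T\<in>R. \<forall>a b. f (oper_lincomb I a S b T) = a * f S + b * f T) \<and>
     f (oper_id I) = 1 \<and>
     (\<forall>T\<in>R. positive_oper I T \<longrightarrow> f T \<in> \<real>\<^sub>\<ge>\<^sub>0)}"

definition pure_states :: "'i set \<Rightarrow> 'i oper set \<Rightarrow> ('i oper \<Rightarrow> complex) set" where
  "pure_states I R = {f \<in> states I R.
     \<forall>g\<in>states I R. \<forall>h\<in>states I R. \<forall>t::real. 0 < t \<and> t < 1 \<and>
       f = (\<lambda>T\<in>R. of_real t * g T + of_real (1 - t) * h T) \<longrightarrow> g = f \<and> h = f}"

definition Kadison_Singer :: bool where
  "Kadison_Singer \<longleftrightarrow>
     (\<forall>f \<in> pure_states (UNIV :: nat set) (diagonal_opers UNIV).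
        \<exists>!g. g \<in> states (UNIV :: nat set) (bounded_opers UNIV) \<and>
             restrict g (diagonal_opers UNIV) = f)"

end

theory Submission
  imports Defs
begin

text \<open>
  A pure state \<open>f\<close> of the diagonal takes only the values 0 and 1 on the coordinate projections
  \<open>Q\<^sub>A\<close>, and it always has the extension \<open>T \<mapsto> f (diagonal part of T)\<close>. If \<open>f Q\<^sub>A = 1\<close>, every extension
  \<open>g\<close> is carried by \<open>Q\<^sub>A\<close>: a hermitian \<open>H\<close> whose quadratic form is at most \<open>\<eta> \<parallel>x\<parallel>\<^sup>2\<close> in absolute value for
  \<open>x\<close> supported in \<open>A\<close> satisfies \<open>\<bar>g H\<bar> \<le> \<eta>\<close> (\<open>state_le_of_form_le_on\<close>). So the extension is unique as soon
  as hermitian operators with zero diagonal can be paved: for each \<open>\<eta> > 0\<close> the index set splits into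
  finitely many classes on which the form of \<open>H\<close> is at most \<open>\<eta> \<parallel>x\<parallel>\<^sup>2\<close>.

  Paving follows from the partition property by colouring twice. A colouring with \<open>s\<close> colours
  that minimises the weight \<open>\<bar>H\<^sub>i\<^sub>j\<bar>\<^sup>2\<close> inside the colour classes leaves in each column at most the fraction \<open>1/s\<close> of its
  square mass within its own class (\<open>balanced_colouring\<close>), so the columns of the compressions of \<open>H\<close> have
  norm at most \<open>\<epsilon>\<close>, with \<open>s\<close> independent of the dimension. Divided by \<open>\<epsilon>\<close>, these compressions
  have columns of norm at most 1 and norm at most \<open>\<parallel>H\<parallel> / \<epsilon>\<close>. The partition property, applied to a padded
  matrix with unit columns and a prescribed norm, splits each class
  into finitely many pieces on which the norm is at most \<open>sqrt D\<close>
  (\<open>partition_columns\<close>). Undoing the division leaves the bound \<open>\<epsilon> sqrt D\<close>, which is as small as desired because \<open>D\<close> does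
  not depend on the norm, and hence not on \<open>\<epsilon>\<close>. The number of colours depends only on \<open>\<parallel>H\<parallel>\<close> and \<open>\<eta>\<close>,
  so the colourings of the finite sections converge along an ultrafilter to a colouring of all indices
  (\<open>infinite_paving\<close>).

  For the converse, \<open>D = 2\<close> works. If for some norm no number of classes suffices,
  take for each \<open>R\<close> a matrix that needs more than \<open>R\<close> classes, and let \<open>T\<close> be the direct sum. The sets \<open>B\<close> with \<open>\<parallel>T x\<parallel>\<^sup>2 \<le> 2 \<parallel>x\<parallel>\<^sup>2\<close>
  for all \<open>x\<close> supported in \<open>B\<close> then have no finite subfamily that covers the indices, so some ultrafilter \<open>U\<close>
  contains none of them. The limit along \<open>U\<close> of the vector states at the basis vectors restricts
  to a pure state of the diagonal. A limit of vector states at unit vectors \<open>x\<close>, supported in ever smaller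
  members of \<open>U\<close>, restricts to the same pure state, and \<open>x\<close> can be chosen with \<open>\<parallel>T x\<parallel>\<^sup>2 \<ge> 2\<close>. At \<open>T\<^sup>* T\<close> the first limit is at most 1 and the
  second at least 2 (\<open>no_bounded_cover_imp_not_KS\<close>).
\<close>

section \<open>Ultrafilters\<close>

definition ultrafilter :: "'a filter \<Rightarrow> bool" where
  "ultrafilter U \<longleftrightarrow> U \<noteq> bot \<and> (\<forall>P. eventually P U \<or> eventually (\<lambda>x. \<not> P x) U)"

lemma ultrafilterD: "ultrafilter U \<Longrightarrow> U \<noteq> bot" "ultrafilter U \<Longrightarrow> \<not> eventually P U \<Longrightarrow> eventually (\<lambda>x. \<not> P x) U"
  by (auto simp: ultrafilter_def)

text \<open>
  A minimal proper filter below \<open>F\<close> decides every predicate: otherwise intersecting it with the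
  predicate would give a smaller proper filter. Zorn's lemma supplies one, since the infimum of a chain of proper
  filters is proper.
\<close>

lemma ultrafilter_exists:
  assumes "F \<noteq> (bot :: 'a filter)"
  shows "\<exists>U\<le>F. ultrafilter U"
proof -
  have "\<exists>M\<in>{G. G \<noteq> bot \<and> G \<le> F}. \<forall>G\<in>{G. G \<noteq> bot \<and> G \<le> F}. G \<le> M \<longrightarrow> G = M"
  proof (rule predicate_Zorn[where P = "\<lambda>G H. H \<le> G"])
    show "partial_order_on {G. G \<noteq> bot \<and> G \<le> F} (relation_of (\<lambda>G H. H \<le> G) {G. G \<noteq> bot \<and> G \<le> F})"
      by (rule partial_order_on_relation_ofI) auto
  next
    fix C assume C: "C \<in> Chains (relation_of (\<lambda>G H. H \<le> G) {G. G \<noteq> bot \<and> G \<le> F})"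
    then have C1: "\<And>G. G \<in> C \<Longrightarrow> G \<noteq> bot \<and> G \<le> F"
      and C2: "\<And>G H. G \<in> C \<Longrightarrow> H \<in> C \<Longrightarrow> G \<le> H \<or> H \<le> G"
      unfolding Chains_def relation_of_def by auto
    show "\<exists>G\<in>{G. G \<noteq> bot \<and> G \<le> F}. \<forall>H\<in>C. G \<le> H"
    proof (cases "C = {}")
      case True then show ?thesis using assms by auto
    next
      case False
      have base: "\<exists>x\<in>C. x \<le> inf G H" if "G \<in> C" "H \<in> C" for G H
        using C2[OF that] that by (metis inf.absorb1 inf.absorb2 order_refl)
      have "eventually P (Inf C) \<longleftrightarrow> (\<exists>G\<in>C. eventually P G)" for P
        by (rule eventually_Inf_base[OF False base])
      then have "Inf C \<noteq> bot"
        using C1 by (auto simp: trivial_limit_def)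
      moreover have "Inf C \<le> F" using False C1 by (meson Inf_lower2 ex_in_conv)
      ultimately show ?thesis by (auto intro: Inf_lower)
    qed
  qed
  then obtain M where M: "M \<noteq> bot" "M \<le> F" "\<And>G. G \<noteq> bot \<Longrightarrow> G \<le> M \<Longrightarrow> G = M"
    using order_trans by blast
  have "eventually P M \<or> eventually (\<lambda>x. \<not> P x) M" for P
  proof (cases "inf M (principal {x. P x}) = bot")
    case True
    then show ?thesis
      by (auto simp: trivial_limit_def eventually_inf_principal)
  next
    case False
    then have "inf M (principal {x. P x}) = M" by (intro M(3)) auto
    then have "eventually P M"
      by (metis (mono_tags) eventually_inf_principal eventually_mono mem_Collect_eq always_eventually)
    then show ?thesis ..
  qed
  with M show ?thesis unfolding ultrafilter_def by auto
qed

lemma ultrafilter_finite_range: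
  assumes U: "ultrafilter U" and C: "finite C" and ev: "eventually (\<lambda>x. f x \<in> C) U"
  shows "\<exists>c\<in>C. eventually (\<lambda>x. f x = c) U"
proof (rule ccontr)
  assume "\<not> ?thesis"
  then have "\<forall>c\<in>C. eventually (\<lambda>x. f x \<noteq> c) U" using ultrafilterD(2)[OF U] by auto
  then have "eventually (\<lambda>x. \<forall>c\<in>C. f x \<noteq> c) U"
    using C by (simp add: eventually_ball_finite_distrib)
  with ev have "eventually (\<lambda>x. False) U" by eventually_elim auto
  then show False using ultrafilterD(1)[OF U] by (simp add: trivial_limit_def)
qed

text \<open>
  Compactness of the disc gives a cluster point, and an ultrafilter converges to each of its cluster points.
\<close>

lemma ultrafilter_bounded_limit:
  fixes f :: "'a \<Rightarrow> complex"
  assumes U: "ultrafilter U" and ev: "eventually (\<lambda>x. cmod (f x) \<le> K) U"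
  shows "\<exists>l. (f \<longlongrightarrow> l) U"
proof -
  let ?G = "filtermap f U"
  have "?G \<noteq> bot" "eventually (\<lambda>z. z \<in> cball 0 K) ?G"
    using ultrafilterD(1)[OF U] ev by (auto simp: filtermap_bot_iff eventually_filtermap)
  then obtain l where l: "inf (nhds l) ?G \<noteq> bot"
    using compact_cball[of "0::complex" K] unfolding compact_filter by blast
  have "(f \<longlongrightarrow> l) U"
    unfolding filterlim_def le_filter_def
  proof (intro allI impI)
    fix P assume P: "eventually P (nhds l)"
    show "eventually P ?G"
    proof (rule ccontr)
      assume "\<not> eventually P ?G"
      then have "eventually (\<lambda>z. \<not> P z) ?G"
        using ultrafilterD(2)[OF U] by (simp add: eventually_filtermap)
      with P have "eventually (\<lambda>z. False) (inf (nhds l) ?G)"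
        unfolding eventually_inf by blast
      with l show False by (simp add: trivial_limit_def)
    qed
  qed
  then show ?thesis ..
qed

lemma ultrafilter_filtermap: "ultrafilter U \<Longrightarrow> ultrafilter (filtermap f U)"
  by (auto simp: ultrafilter_def filtermap_bot_iff eventually_filtermap)

section \<open>Square-summable families\<close>

abbreviation sqn :: "('i \<Rightarrow> complex) \<Rightarrow> real" where
  "sqn x \<equiv> (ell2_norm UNIV x)\<^sup>2"

text \<open>
  Vectors supported in \<open>A\<close> are described throughout as the fixed points of \<open>clip A\<close>.
\<close>

definition clip :: "'i set \<Rightarrow> ('i \<Rightarrow> complex) \<Rightarrow> 'i \<Rightarrow> complex" where
  "clip A x = (\<lambda>i. if i \<in> A then x i else 0)"

lemma ell2_norm_nonneg [simp]: "0 \<le> ell2_norm I x"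
  unfolding ell2_norm_def by (intro real_sqrt_ge_zero infsum_nonneg) auto

lemma ell2_norm_sq: "(ell2_norm I x)\<^sup>2 = (\<Sum>\<^sub>\<infinity>i\<in>I. (cmod (x i))\<^sup>2)"
  unfolding ell2_norm_def by (intro real_sqrt_pow2 infsum_nonneg) auto

lemma ell2_norm_sq_finite: "finite I \<Longrightarrow> (ell2_norm I x)\<^sup>2 = (\<Sum>i\<in>I. (cmod (x i))\<^sup>2)"
  by (simp add: ell2_norm_sq)

lemma ell2_UNIV: "x \<in> ell2 UNIV \<longleftrightarrow> (\<lambda>i. (cmod (x i))\<^sup>2) summable_on UNIV"
  by (simp add: ell2_def)

text \<open>
  Norm bounds in infinite dimension are always obtained from bounds on finite partial sums.
\<close>

lemma ell2_bounded_sums: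
  assumes "\<And>F. finite F \<Longrightarrow> (\<Sum>i\<in>F. (cmod (x i))\<^sup>2) \<le> K"
  shows "x \<in> ell2 UNIV" "sqn x \<le> K"
proof -
  show x: "x \<in> ell2 UNIV"
    unfolding ell2_UNIV by (rule nonneg_bounded_partial_sums_imp_summable_on[where C = K])
      (auto intro!: eventually_finite_subsets_at_top_weakI assms)
  show "sqn x \<le> K" unfolding ell2_norm_sq
    by (rule infsum_le_finite_sums) (use x assms in \<open>auto simp: ell2_UNIV\<close>)
qed

lemma ell2_finite_sum_le: "x \<in> ell2 UNIV \<Longrightarrow> finite F \<Longrightarrow> (\<Sum>i\<in>F. (cmod (x i))\<^sup>2) \<le> sqn x"
  unfolding ell2_norm_sq by (rule finite_sum_le_infsum) (auto simp: ell2_UNIV)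

lemma ell2_component_le: "x \<in> ell2 UNIV \<Longrightarrow> cmod (x i) \<le> ell2_norm UNIV x"
  using ell2_finite_sum_le[of x "{i}"] by (simp add: power2_le_iff_abs_le)

lemma cmod_add_sq_le: "(cmod (a + b))\<^sup>2 \<le> 2 * (cmod a)\<^sup>2 + 2 * (cmod b)\<^sup>2"
proof -
  have "(cmod (a + b))\<^sup>2 \<le> (cmod a + cmod b)\<^sup>2" by (intro power_mono norm_triangle_ineq) auto
  also have "\<dots> \<le> 2 * (cmod a)\<^sup>2 + 2 * (cmod b)\<^sup>2"
    using sum_squares_bound[of "cmod a" "cmod b"] by (simp add: power2_sum)
  finally show ?thesis .
qed

lemma ell2_norm_triangle:
  assumes "x \<in> ell2 UNIV" "y \<in> ell2 UNIV"
  shows "ell2_norm UNIV (\<lambda>i. x i + y i) \<le> ell2_norm UNIV x + ell2_norm UNIV y"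
proof -
  have "(\<Sum>i\<in>F. (cmod (x i + y i))\<^sup>2) \<le> (ell2_norm UNIV x + ell2_norm UNIV y)\<^sup>2" if F: "finite F" for F
  proof -
    have le: "L2_set (\<lambda>i. cmod (z i)) F \<le> ell2_norm UNIV z" if "z \<in> ell2 UNIV" for z
      unfolding L2_set_def by (rule real_le_lsqrt) (use ell2_finite_sum_le[OF that F] in auto)
    have "L2_set (\<lambda>i. cmod (x i + y i)) F \<le> L2_set (\<lambda>i. cmod (x i) + cmod (y i)) F"
      by (rule L2_set_mono) (auto intro: norm_triangle_ineq)
    also have "\<dots> \<le> L2_set (\<lambda>i. cmod (x i)) F + L2_set (\<lambda>i. cmod (y i)) F" by (rule L2_set_triangle_ineq)
    also have "\<dots> \<le> ell2_norm UNIV x + ell2_norm UNIV y"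
      by (intro add_mono le assms)
    finally have "(L2_set (\<lambda>i. cmod (x i + y i)) F)\<^sup>2 \<le> (ell2_norm UNIV x + ell2_norm UNIV y)\<^sup>2"
      by (rule power_mono) (rule L2_set_nonneg)
    then show ?thesis by (simp add: L2_set_def sum_nonneg)
  qed
  then have "sqn (\<lambda>i. x i + y i) \<le> (ell2_norm UNIV x + ell2_norm UNIV y)\<^sup>2"
    by (rule ell2_bounded_sums(2))
  then show ?thesis by (rule power2_le_imp_le) auto
qed

lemma ell2_scale: "x \<in> ell2 I \<Longrightarrow> (\<lambda>i. a * x i) \<in> ell2 I"
  by (auto simp: ell2_def norm_mult power_mult_distrib intro: summable_on_cmult_right)

lemma ell2_add: assumes "x \<in> ell2 I" "y \<in> ell2 I" shows "(\<lambda>i. x i + y i) \<in> ell2 I"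
proof -
  have "(\<lambda>i. (cmod (x i + y i))\<^sup>2) summable_on I"
  proof (rule summable_on_comparison_test)
    show "(\<lambda>i. 2 * (cmod (x i))\<^sup>2 + 2 * (cmod (y i))\<^sup>2) summable_on I"
      using assms by (auto simp: ell2_def intro!: summable_on_add summable_on_cmult_right)
  qed (use cmod_add_sq_le in auto)
  then show ?thesis using assms by (auto simp: ell2_def)
qed

lemma ell2_lincomb: "x \<in> ell2 I \<Longrightarrow> y \<in> ell2 I \<Longrightarrow> (\<lambda>i. a * x i + b * y i) \<in> ell2 I"
  by (intro ell2_add ell2_scale)

lemma ell2_mult:
  assumes "x \<in> ell2 UNIV" "\<And>i. cmod (d i) \<le> K"
  shows "(\<lambda>i. d i * x i) \<in> ell2 UNIV" "ell2_norm UNIV (\<lambda>i. d i * x i) \<le> K * ell2_norm UNIV x"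
proof -
  have K: "0 \<le> K" using assms(2)[of undefined] norm_ge_zero order_trans by blast
  have *: "(\<Sum>i\<in>F. (cmod (d i * x i))\<^sup>2) \<le> K\<^sup>2 * sqn x" if "finite F" for F
  proof -
    have "(\<Sum>i\<in>F. (cmod (d i * x i))\<^sup>2) \<le> (\<Sum>i\<in>F. K\<^sup>2 * (cmod (x i))\<^sup>2)"
      by (intro sum_mono) (auto simp: norm_mult power_mult_distrib intro!: mult_right_mono power_mono assms)
    also have "\<dots> \<le> K\<^sup>2 * sqn x" unfolding sum_distrib_left[symmetric]
      by (intro mult_left_mono ell2_finite_sum_le assms that) auto
    finally show ?thesis .
  qed
  show "(\<lambda>i. d i * x i) \<in> ell2 UNIV" by (rule ell2_bounded_sums(1)[OF *])
  have "sqn (\<lambda>i. d i * x i) \<le> (K * ell2_norm UNIV x)\<^sup>2"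
    using ell2_bounded_sums(2)[OF *] by (simp add: power_mult_distrib)
  then show "ell2_norm UNIV (\<lambda>i. d i * x i) \<le> K * ell2_norm UNIV x"
    by (rule power2_le_imp_le) (auto intro: mult_nonneg_nonneg K)
qed

lemma clip_as_mult: "clip A x = (\<lambda>i. (if i \<in> A then 1 else 0) * x i)"
  by (auto simp: clip_def)

lemma clip_ell2: "x \<in> ell2 UNIV \<Longrightarrow> clip A x \<in> ell2 UNIV"
  unfolding clip_as_mult by (rule ell2_mult(1)[where K = 1]) auto

lemma finite_support_ell2: "finite {i. x i \<noteq> 0} \<Longrightarrow> x \<in> ell2 UNIV"
  unfolding ell2_UNIV by (rule finite_nonzero_values_imp_summable_on) auto

lemma basis_ell2: "ell2_basis k \<in> ell2 UNIV"
  by (rule finite_support_ell2) (auto simp: ell2_basis_def)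

lemma infsum_finite_support:
  fixes x :: "'i \<Rightarrow> complex"
  assumes "finite F" "\<And>i. i \<notin> F \<Longrightarrow> x i = 0"
  shows "(\<Sum>\<^sub>\<infinity>i. (cmod (x i))\<^sup>2) = (\<Sum>i\<in>F. (cmod (x i))\<^sup>2)"
proof -
  have "(\<Sum>\<^sub>\<infinity>i. (cmod (x i))\<^sup>2) = (\<Sum>\<^sub>\<infinity>i\<in>F. (cmod (x i))\<^sup>2)"
    by (rule infsum_cong_neutral) (use assms(2) in auto)
  then show ?thesis using assms(1) by simp
qed

lemma finite_support_sqn:
  "finite F \<Longrightarrow> (\<And>i. i \<notin> F \<Longrightarrow> x i = 0) \<Longrightarrow> sqn x = (\<Sum>i\<in>F. (cmod (x i))\<^sup>2)"
  unfolding ell2_norm_sq by (rule infsum_finite_support)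

lemma basis_norm: "ell2_norm UNIV (ell2_basis k) = 1"
proof -
  have "sqn (ell2_basis k) = 1"
    by (subst finite_support_sqn[of "{k}"]) (auto simp: ell2_basis_def)
  then show ?thesis by (metis abs_of_nonneg abs_square_eq_1 ell2_norm_nonneg)
qed

lemma sqn_clip_split: "x \<in> ell2 UNIV \<Longrightarrow> sqn x = sqn (clip A x) + sqn (clip (-A) x)"
  unfolding ell2_norm_sq
  by (subst infsum_add[symmetric])
    (use clip_ell2[of x A] clip_ell2[of x "-A"] in
      \<open>auto simp: ell2_UNIV clip_def intro!: infsum_cong\<close>)

lemma clip_norm_le: "x \<in> ell2 UNIV \<Longrightarrow> ell2_norm UNIV (clip A x) \<le> ell2_norm UNIV x"
  by (rule power2_le_imp_le) (use sqn_clip_split[of x A] in auto)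

lemma ell2_norm_0 [simp]: "ell2_norm I (\<lambda>i. 0) = 0"
  by (simp add: ell2_norm_def)

lemma ell2_norm_eq_0: "x \<in> ell2 UNIV \<Longrightarrow> ell2_norm UNIV x = 0 \<Longrightarrow> x = (\<lambda>i. 0)"
  using ell2_component_le[of x] by auto

lemma ell2_norm_scale: "ell2_norm I (\<lambda>i. a * x i) = cmod a * ell2_norm I x"
  by (simp add: ell2_norm_def norm_mult power_mult_distrib infsum_cmult_right' real_sqrt_mult)

subsection \<open>Inner product\<close>

lemma inner_product_summable:
  assumes "x \<in> ell2 UNIV" "y \<in> ell2 UNIV"
  shows "(\<lambda>i. x i * cnj (y i)) summable_on UNIV"
    and "cmod (ell2_inner UNIV x y) \<le> ell2_norm UNIV x * ell2_norm UNIV y"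
proof -
  have fin: "(\<Sum>i\<in>F. cmod (x i * cnj (y i))) \<le> ell2_norm UNIV x * ell2_norm UNIV y" if "finite F" for F
  proof -
    have "(\<Sum>i\<in>F. cmod (x i * cnj (y i))) = (\<Sum>i\<in>F. \<bar>cmod (x i)\<bar> * \<bar>cmod (y i)\<bar>)"
      by (simp add: norm_mult)
    also have "\<dots> \<le> L2_set (\<lambda>i. cmod (x i)) F * L2_set (\<lambda>i. cmod (y i)) F" by (rule L2_set_mult_ineq)
    also have "\<dots> \<le> ell2_norm UNIV x * ell2_norm UNIV y"
      using ell2_finite_sum_le[OF assms(1) that] ell2_finite_sum_le[OF assms(2) that]
      by (intro mult_mono) (auto simp: L2_set_def real_le_lsqrt real_sqrt_le_iff intro!: real_le_lsqrt sum_nonneg)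
    finally show ?thesis .
  qed
  have abs: "(\<lambda>i. cmod (x i * cnj (y i))) summable_on UNIV"
    by (rule nonneg_bounded_partial_sums_imp_summable_on[where C = "ell2_norm UNIV x * ell2_norm UNIV y"])
      (auto intro!: eventually_finite_subsets_at_top_weakI fin)
  then show "(\<lambda>i. x i * cnj (y i)) summable_on UNIV" by (rule abs_summable_summable)
  have "cmod (ell2_inner UNIV x y) \<le> (\<Sum>\<^sub>\<infinity>i. cmod (x i * cnj (y i)))"
    unfolding ell2_inner_def by (rule norm_infsum_bound) (use abs in auto)
  also have "\<dots> \<le> ell2_norm UNIV x * ell2_norm UNIV y"
    by (rule infsum_le_finite_sums) (use abs fin in auto)
  finally show "cmod (ell2_inner UNIV x y) \<le> ell2_norm UNIV x * ell2_norm UNIV y" .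
qed

lemma inner_lincomb_left:
  assumes "x \<in> ell2 UNIV" "y \<in> ell2 UNIV" "z \<in> ell2 UNIV"
  shows "ell2_inner UNIV (\<lambda>i. a * x i + b * y i) z = a * ell2_inner UNIV x z + b * ell2_inner UNIV y z"
  unfolding ell2_inner_def
  using inner_product_summable(1)[OF assms(1,3)] inner_product_summable(1)[OF assms(2,3)]
  by (simp add: distrib_right mult.assoc infsum_add infsum_cmult_right' summable_on_cmult_right)

lemma inner_commute: "ell2_inner I x y = cnj (ell2_inner I y x)"
  unfolding ell2_inner_def by (subst infsum_cnj[symmetric]) (simp add: mult.commute)

lemma inner_lincomb_right:
  assumes "x \<in> ell2 UNIV" "y \<in> ell2 UNIV" "z \<in> ell2 UNIV"
  shows "ell2_inner UNIV z (\<lambda>i. a * x i + b * y i) = cnj a * ell2_inner UNIV z x + cnj b * ell2_inner UNIV z y"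
  by (subst (1 2 3) inner_commute) (simp add: inner_lincomb_left assms)

lemma inner_self: "x \<in> ell2 UNIV \<Longrightarrow> ell2_inner UNIV x x = of_real (sqn x)"
  unfolding ell2_inner_def ell2_norm_sq
  by (rule infsumI) (auto simp: ell2_UNIV complex_norm_square[symmetric] simp flip: of_real_power
      intro!: has_sum_of_real has_sum_infsum)

lemma inner_basis_right: "ell2_inner UNIV x (ell2_basis k) = x k"
proof -
  have "ell2_inner UNIV x (ell2_basis k) = (\<Sum>\<^sub>\<infinity>i\<in>{k}. x i)"
    unfolding ell2_inner_def ell2_basis_def by (rule infsum_cong_neutral) auto
  then show ?thesis by simp
qed

lemma norm_clip_compl_tendsto:
  assumes "x \<in> ell2 UNIV"
  shows "((\<lambda>F. ell2_norm UNIV (clip (-F) x)) \<longlongrightarrow> 0) (finite_subsets_at_top UNIV)"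
proof -
  have "((\<lambda>F. \<Sum>i\<in>F. (cmod (x i))\<^sup>2) \<longlongrightarrow> sqn x) (finite_subsets_at_top UNIV)"
    unfolding ell2_norm_sq using assms by (intro infsum_tendsto) (auto simp: ell2_UNIV)
  then have "((\<lambda>F. sqn x - (\<Sum>i\<in>F. (cmod (x i))\<^sup>2)) \<longlongrightarrow> sqn x - sqn x) (finite_subsets_at_top UNIV)"
    by (intro tendsto_diff tendsto_const)
  moreover have "eventually (\<lambda>F. sqn x - (\<Sum>i\<in>F. (cmod (x i))\<^sup>2) = sqn (clip (-F) x)) (finite_subsets_at_top UNIV)"
  proof (rule eventually_finite_subsets_at_top_weakI)
    fix F :: "'a set" assume "finite F"
    then have "sqn (clip F x) = (\<Sum>i\<in>F. (cmod (x i))\<^sup>2)"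
      by (subst finite_support_sqn[of F]) (auto simp: clip_def)
    then show "sqn x - (\<Sum>i\<in>F. (cmod (x i))\<^sup>2) = sqn (clip (-F) x)"
      using sqn_clip_split[OF assms, of F] by simp
  qed
  ultimately have "((\<lambda>F. sqn (clip (-F) x)) \<longlongrightarrow> 0) (finite_subsets_at_top UNIV)"
    using tendsto_cong by fastforce
  then have "((\<lambda>F. sqrt (sqn (clip (-F) x))) \<longlongrightarrow> sqrt 0) (finite_subsets_at_top UNIV)"
    by (rule tendsto_real_sqrt)
  then show ?thesis by simp
qed

section \<open>Bounded operators\<close>

lemma oper_in: "T \<in> bounded_opers I \<Longrightarrow> x \<in> ell2 I \<Longrightarrow> T x \<in> ell2 I"
  by (auto simp: bounded_opers_def)

lemma oper_linear: "T \<in> bounded_opers I \<Longrightarrow> x \<in> ell2 I \<Longrightarrow> y \<in> ell2 I \<Longrightarrow>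
    T (\<lambda>i. a * x i + b * y i) = (\<lambda>i. a * T x i + b * T y i)"
  by (auto simp: bounded_opers_def)

lemma oper_scale: "T \<in> bounded_opers I \<Longrightarrow> x \<in> ell2 I \<Longrightarrow> T (\<lambda>i. a * x i) = (\<lambda>i. a * T x i)"
  using oper_linear[of T I x x a 0] by simp

lemma oper_add: "T \<in> bounded_opers I \<Longrightarrow> x \<in> ell2 I \<Longrightarrow> y \<in> ell2 I \<Longrightarrow>
    T (\<lambda>i. x i + y i) = (\<lambda>i. T x i + T y i)"
  using oper_linear[of T I x y 1 1] by simp

lemma oper_zero: "T \<in> bounded_opers I \<Longrightarrow> T (\<lambda>i. 0) = (\<lambda>i. 0)"
  using oper_scale[of T I "\<lambda>i. 0" 0] by (simp add: ell2_def)

lemma oper_bounded: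
  assumes "T \<in> bounded_opers I"
  obtains K where "0 \<le> K" "\<And>x. x \<in> ell2 I \<Longrightarrow> ell2_norm I (T x) \<le> K * ell2_norm I x"
proof -
  obtain K where K: "\<And>x. x \<in> ell2 I \<Longrightarrow> ell2_norm I (T x) \<le> K * ell2_norm I x"
    using assms unfolding bounded_opers_def by blast
  have "ell2_norm I (T x) \<le> max K 0 * ell2_norm I x" if "x \<in> ell2 I" for x
    using K[OF that] by (rule order_trans) (auto intro: mult_right_mono)
  then show ?thesis using that[of "max K 0"] by auto
qed

lemma oper_eqI:
  assumes "S \<in> extensional (ell2 I)" "T \<in> extensional (ell2 I)" "\<And>x. x \<in> ell2 I \<Longrightarrow> S x = T x"
  shows "S = T"
  using assms by (rule extensionalityI)

lemma oper_extensional: "T \<in> bounded_opers I \<Longrightarrow> T \<in> extensional (ell2 I)"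
  by (auto simp: bounded_opers_def PiE_def)

lemma bounded_opersI:
  assumes "\<And>x. x \<in> ell2 I \<Longrightarrow> f x \<in> ell2 I"
    and "\<And>x y a b. x \<in> ell2 I \<Longrightarrow> y \<in> ell2 I \<Longrightarrow> f (\<lambda>i. a * x i + b * y i) = (\<lambda>i. a * f x i + b * f y i)"
    and "\<And>x. x \<in> ell2 I \<Longrightarrow> ell2_norm I (f x) \<le> K * ell2_norm I x"
  shows "(\<lambda>x\<in>ell2 I. f x) \<in> bounded_opers I"
  using assms(1,2) by (auto simp: bounded_opers_def ell2_lincomb intro!: exI[of _ K] assms(3))

lemma lincomb_in:
  assumes S: "S \<in> bounded_opers UNIV" and T: "T \<in> bounded_opers UNIV"
  shows "oper_lincomb UNIV a S b T \<in> bounded_opers UNIV"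
proof -
  obtain K where K: "\<And>x. x \<in> ell2 UNIV \<Longrightarrow> ell2_norm UNIV (S x) \<le> K * ell2_norm UNIV x"
    using oper_bounded[OF S] by blast
  obtain L where L: "\<And>x. x \<in> ell2 UNIV \<Longrightarrow> ell2_norm UNIV (T x) \<le> L * ell2_norm UNIV x"
    using oper_bounded[OF T] by blast
  show ?thesis unfolding oper_lincomb_def
  proof (rule bounded_opersI)
    fix x :: "'a \<Rightarrow> complex" assume x: "x \<in> ell2 UNIV"
    show "(\<lambda>i. a * S x i + b * T x i) \<in> ell2 UNIV" by (intro ell2_lincomb oper_in[OF S] oper_in[OF T] x)
    have "ell2_norm UNIV (\<lambda>i. a * S x i + b * T x i)
        \<le> cmod a * ell2_norm UNIV (S x) + cmod b * ell2_norm UNIV (T x)"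
      using ell2_norm_triangle[OF ell2_scale[OF oper_in[OF S x], of a] ell2_scale[OF oper_in[OF T x], of b]]
      by (simp add: ell2_norm_scale)
    also have "\<dots> \<le> cmod a * (K * ell2_norm UNIV x) + cmod b * (L * ell2_norm UNIV x)"
      by (intro add_mono mult_left_mono K L x) auto
    finally show "ell2_norm UNIV (\<lambda>i. a * S x i + b * T x i) \<le> (cmod a * K + cmod b * L) * ell2_norm UNIV x"
      by (simp add: algebra_simps)
  qed (auto simp: oper_linear[OF S] oper_linear[OF T] algebra_simps)
qed

lemma lincomb_apply: "x \<in> ell2 I \<Longrightarrow> oper_lincomb I a S b T x = (\<lambda>i. a * S x i + b * T x i)"
  by (simp add: oper_lincomb_def)

lemma inner_oper_lincomb:
  assumes "S \<in> bounded_opers UNIV" "T \<in> bounded_opers UNIV" "x \<in> ell2 UNIV" "y \<in> ell2 UNIV"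
  shows "ell2_inner UNIV (oper_lincomb UNIV a S b T x) y
      = a * ell2_inner UNIV (S x) y + b * ell2_inner UNIV (T x) y"
    and "ell2_inner UNIV y (oper_lincomb UNIV a S b T x)
      = cnj a * ell2_inner UNIV y (S x) + cnj b * ell2_inner UNIV y (T x)"
  by (simp_all add: lincomb_apply assms inner_lincomb_left inner_lincomb_right oper_in)

lemma inner_oper_le:
  assumes T: "T \<in> bounded_opers UNIV" and x: "x \<in> ell2 UNIV" and y: "y \<in> ell2 UNIV"
    and K: "\<And>x. x \<in> ell2 UNIV \<Longrightarrow> ell2_norm UNIV (T x) \<le> K * ell2_norm UNIV x"
  shows "cmod (ell2_inner UNIV (T x) y) \<le> K * ell2_norm UNIV x * ell2_norm UNIV y"
proof -
  have "cmod (ell2_inner UNIV (T x) y) \<le> ell2_norm UNIV (T x) * ell2_norm UNIV y"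
    by (rule inner_product_summable(2)[OF oper_in[OF T x] y])
  also have "\<dots> \<le> K * ell2_norm UNIV x * ell2_norm UNIV y"
    by (intro mult_right_mono K x) auto
  finally show ?thesis .
qed

subsection \<open>Diagonal operators\<close>

definition diag :: "('i \<Rightarrow> complex) \<Rightarrow> 'i oper" where
  "diag d = (\<lambda>x\<in>ell2 UNIV. \<lambda>i. d i * x i)"

definition proj :: "'i set \<Rightarrow> 'i oper" where
  "proj A = diag (\<lambda>i. if i \<in> A then 1 else 0)"

lemma diag_apply: "x \<in> ell2 UNIV \<Longrightarrow> diag d x = (\<lambda>i. d i * x i)"
  by (simp add: diag_def)

lemma diag_in:
  assumes "\<And>i. cmod (d i) \<le> K"
  shows "diag d \<in> diagonal_opers UNIV"
proof -
  have "diag d \<in> bounded_opers UNIV"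
    unfolding diag_def
    by (rule bounded_opersI[where K = K])
      (simp_all only: ell2_mult[OF _ assms], simp add: algebra_simps)
  then show ?thesis unfolding diagonal_opers_def using diag_apply by blast
qed

lemma diagonal_subset_bounded: "diagonal_opers I \<subseteq> bounded_opers I"
  by (auto simp: diagonal_opers_def)

lemma diagonalE:
  assumes "T \<in> diagonal_opers UNIV"
  obtains d K where "T = diag d" "0 \<le> K" "\<And>i. cmod (d i) \<le> K"
proof -
  obtain d where T: "T \<in> bounded_opers UNIV" and d: "\<And>x. x \<in> ell2 UNIV \<Longrightarrow> T x = (\<lambda>i. d i * x i)"
    using assms by (auto simp: diagonal_opers_def)
  obtain K where K: "0 \<le> K" "\<And>x. x \<in> ell2 UNIV \<Longrightarrow> ell2_norm UNIV (T x) \<le> K * ell2_norm UNIV x"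
    using oper_bounded[OF T] by blast
  have "cmod (d i) \<le> K" for i
  proof -
    have "cmod (d i) = cmod (T (ell2_basis i) i)" by (simp add: d basis_ell2) (simp add: ell2_basis_def)
    also have "\<dots> \<le> K * 1"
      using ell2_component_le[OF oper_in[OF T basis_ell2]] K(2)[OF basis_ell2] basis_norm order_trans by metis
    finally show ?thesis by simp
  qed
  moreover have "T = diag d"
    using oper_extensional[OF T] unfolding diag_def by (intro oper_eqI) (auto simp: d)
  ultimately show ?thesis using that K(1) by blast
qed

lemma diag_lincomb: "oper_lincomb UNIV a (diag d) b (diag e) = diag (\<lambda>i. a * d i + b * e i)"
  unfolding oper_lincomb_def diag_def by (auto simp: fun_eq_iff restrict_def algebra_simps)

lemma diagonal_lincomb:
  assumes "S \<in> diagonal_opers UNIV" "T \<in> diagonal_opers UNIV"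
  shows "oper_lincomb UNIV a S b T \<in> diagonal_opers UNIV"
proof -
  obtain d K where S: "S = diag d" "\<And>i. cmod (d i) \<le> K" using diagonalE[OF assms(1)] by metis
  obtain e L where T: "T = diag e" "\<And>i. cmod (e i) \<le> L" using diagonalE[OF assms(2)] by metis
  have "cmod (a * d i + b * e i) \<le> cmod a * K + cmod b * L" for i
    using S(2)[of i] T(2)[of i]
    by (intro norm_triangle_le) (auto simp: norm_mult intro!: add_mono mult_left_mono)
  then show ?thesis unfolding S(1) T(1) diag_lincomb by (rule diag_in)
qed

lemma proj_in: "proj A \<in> diagonal_opers UNIV"
  unfolding proj_def by (rule diag_in[where K = 1]) auto

lemma id_diag: "oper_id UNIV = diag (\<lambda>i. 1)"
  by (simp add: oper_id_def diag_def)

lemma id_in: "oper_id UNIV \<in> diagonal_opers UNIV"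
  unfolding id_diag by (rule diag_in[where K = 1]) auto

lemma proj_apply: "x \<in> ell2 UNIV \<Longrightarrow> proj A x = clip A x"
  by (simp add: proj_def diag_apply clip_as_mult)

lemma proj_compl: "oper_lincomb UNIV 1 (proj A) 1 (proj (-A)) = oper_id UNIV"
  unfolding proj_def diag_lincomb id_diag by (intro arg_cong[where f = diag]) auto

lemma inner_proj: "x \<in> ell2 UNIV \<Longrightarrow> ell2_inner UNIV (proj A x) x = of_real (sqn (clip A x))"
proof -
  assume x: "x \<in> ell2 UNIV"
  have "ell2_inner UNIV (proj A x) x = ell2_inner UNIV (clip A x) (clip A x)"
    unfolding proj_apply[OF x] ell2_inner_def by (rule infsum_cong) (auto simp: clip_def)
  then show ?thesis using inner_self[OF clip_ell2[OF x]] by simp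
qed

lemma diag_entry: "diag d (ell2_basis k) k = d k"
  by (simp add: diag_apply basis_ell2) (simp add: ell2_basis_def)

lemma inner_diag: "x \<in> ell2 UNIV \<Longrightarrow> ell2_inner UNIV (diag d x) x = (\<Sum>\<^sub>\<infinity>i. d i * of_real ((cmod (x i))\<^sup>2))"
  by (simp add: diag_apply ell2_inner_def complex_norm_square[symmetric] mult.assoc)

subsection \<open>Adjoints\<close>

lemma oper_clip_finite:
  assumes T: "T \<in> bounded_opers UNIV" and y: "y \<in> ell2 UNIV" and "finite F"
  shows "ell2_inner UNIV (T (clip F x)) y = (\<Sum>k\<in>F. x k * ell2_inner UNIV (T (ell2_basis k)) y)"
  using \<open>finite F\<close>
proof (induction F)
  case empty
  then show ?case using oper_zero[OF T] by (simp add: clip_def ell2_inner_def)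
next
  case (insert k F)
  have "clip F x \<in> ell2 UNIV"
    by (rule finite_support_ell2, rule finite_subset[OF _ insert.hyps(1)]) (auto simp: clip_def)
  moreover have "clip (insert k F) x = (\<lambda>i. x k * ell2_basis k i + 1 * clip F x i)"
    using insert.hyps by (auto simp: clip_def ell2_basis_def)
  ultimately have "T (clip (insert k F) x) = (\<lambda>i. x k * T (ell2_basis k) i + 1 * T (clip F x) i)"
    using oper_linear[OF T basis_ell2 \<open>clip F x \<in> ell2 UNIV\<close>] by metis
  then show ?case
    using insert inner_lincomb_left[OF oper_in[OF T basis_ell2] oper_in[OF T \<open>clip F x \<in> ell2 UNIV\<close>] y, of "x k" k 1]
    by simp
qed

text \<open>
  The action of an operator is recovered from its columns: by boundedness the error of truncating \<open>x\<close> to a finite set \<open>F\<close> is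
  controlled by the norm of the part of \<open>x\<close> off \<open>F\<close>.
\<close>

lemma oper_matrix_has_sum:
  assumes T: "T \<in> bounded_opers UNIV" and x: "x \<in> ell2 UNIV" and y: "y \<in> ell2 UNIV"
  shows "((\<lambda>k. x k * ell2_inner UNIV (T (ell2_basis k)) y) has_sum ell2_inner UNIV (T x) y) UNIV"
  unfolding has_sum_def
proof -
  obtain K where K: "0 \<le> K" "\<And>x. x \<in> ell2 UNIV \<Longrightarrow> ell2_norm UNIV (T x) \<le> K * ell2_norm UNIV x"
    using oper_bounded[OF T] by blast
  show "((\<lambda>F. \<Sum>k\<in>F. x k * ell2_inner UNIV (T (ell2_basis k)) y) \<longlongrightarrow> ell2_inner UNIV (T x) y)
    (finite_subsets_at_top UNIV)"
  proof (rule LIM_zero_cancel)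
    show "((\<lambda>F. (\<Sum>k\<in>F. x k * ell2_inner UNIV (T (ell2_basis k)) y) - ell2_inner UNIV (T x) y) \<longlongrightarrow> 0)
      (finite_subsets_at_top UNIV)"
    proof (rule Lim_null_comparison)
      show "eventually (\<lambda>F. norm ((\<Sum>k\<in>F. x k * ell2_inner UNIV (T (ell2_basis k)) y) - ell2_inner UNIV (T x) y)
          \<le> K * ell2_norm UNIV (clip (-F) x) * ell2_norm UNIV y) (finite_subsets_at_top UNIV)"
      proof (rule eventually_finite_subsets_at_top_weakI)
        fix F :: "'a set" assume F: "finite F"
        have "(\<lambda>i. clip F x i + clip (-F) x i) = x" by (auto simp: clip_def)
        then have "T x = (\<lambda>i. 1 * T (clip F x) i + 1 * T (clip (-F) x) i)"
          using oper_add[OF T clip_ell2[OF x] clip_ell2[OF x], of F "-F"] by simp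
        then have "ell2_inner UNIV (T x) y = ell2_inner UNIV (T (clip F x)) y + ell2_inner UNIV (T (clip (-F) x)) y"
          using inner_lincomb_left[OF oper_in[OF T clip_ell2[OF x]] oper_in[OF T clip_ell2[OF x]] y, of 1 F 1 "-F"] by simp
        then have "(\<Sum>k\<in>F. x k * ell2_inner UNIV (T (ell2_basis k)) y) - ell2_inner UNIV (T x) y
            = - ell2_inner UNIV (T (clip (-F) x)) y"
          using oper_clip_finite[OF T y F, of x] by simp
        then show "norm ((\<Sum>k\<in>F. x k * ell2_inner UNIV (T (ell2_basis k)) y) - ell2_inner UNIV (T x) y)
          \<le> K * ell2_norm UNIV (clip (-F) x) * ell2_norm UNIV y"
          using inner_oper_le[OF T clip_ell2[OF x] y K(2)] by simp
      qed
      show "((\<lambda>F. K * ell2_norm UNIV (clip (-F) x) * ell2_norm UNIV y) \<longlongrightarrow> 0) (finite_subsets_at_top UNIV)"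
        using tendsto_mult_right[OF tendsto_mult_left[OF norm_clip_compl_tendsto[OF x], of K], of "ell2_norm UNIV y"] by simp
    qed
  qed
qed

text \<open>
  The Hilbert space adjoint. Reading its coordinates off the columns avoids the representation theorem for
  functionals.
\<close>

definition adj :: "'i oper \<Rightarrow> 'i oper" where
  "adj T = (\<lambda>x\<in>ell2 UNIV. \<lambda>k. ell2_inner UNIV x (T (ell2_basis k)))"

text \<open>
  Testing \<open>T\<close> on the vector \<open>z\<close> formed by the first coordinates of the candidate \<open>T\<^sup>* y\<close> turns
  the partial sum into \<open>\<langle>T z, y\<rangle>\<close>, so that \<open>\<parallel>z\<parallel>\<^sup>2 \<le> K \<parallel>z\<parallel> \<parallel>y\<parallel>\<close>.
\<close>

lemma adj_partial_sums_le:
  assumes T: "T \<in> bounded_opers UNIV" and y: "y \<in> ell2 UNIV" and K: "0 \<le> K"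
    "\<And>x. x \<in> ell2 UNIV \<Longrightarrow> ell2_norm UNIV (T x) \<le> K * ell2_norm UNIV x"
    and F: "finite F"
  shows "(\<Sum>k\<in>F. (cmod (ell2_inner UNIV y (T (ell2_basis k))))\<^sup>2) \<le> (K * ell2_norm UNIV y)\<^sup>2"
proof -
  define z where "z = clip F (\<lambda>k. ell2_inner UNIV y (T (ell2_basis k)))"
  define S where "S = (\<Sum>k\<in>F. (cmod (ell2_inner UNIV y (T (ell2_basis k))))\<^sup>2)"
  have z: "z \<in> ell2 UNIV"
    unfolding z_def by (rule finite_support_ell2, rule finite_subset[OF _ F]) (auto simp: clip_def)
  have S: "sqn z = S" unfolding z_def S_def
    by (subst finite_support_sqn[OF F]) (auto simp: clip_def)
  have "ell2_inner UNIV (T z) y = of_real S"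
    unfolding z_def S_def oper_clip_finite[OF T y F] of_real_sum
    by (rule sum.cong[OF refl], subst (2) inner_commute) (simp add: complex_norm_square[symmetric])
  then have "S \<le> K * ell2_norm UNIV z * ell2_norm UNIV y"
    using inner_oper_le[OF T z y K(2)] by (simp add: abs_le_iff)
  then have *: "ell2_norm UNIV z * ell2_norm UNIV z \<le> ell2_norm UNIV z * (K * ell2_norm UNIV y)"
    unfolding S[symmetric] by (simp add: power2_eq_square algebra_simps)
  have "ell2_norm UNIV z \<le> K * ell2_norm UNIV y"
  proof (cases "ell2_norm UNIV z = 0")
    case False
    then have "0 < ell2_norm UNIV z" by (simp add: less_le)
    then show ?thesis using * mult_le_cancel_left_pos by blast
  qed (use K in simp)
  then have "sqn z \<le> (K * ell2_norm UNIV y)\<^sup>2" by (intro power_mono) auto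
  then show ?thesis using S unfolding S_def by simp
qed

lemma adj_in:
  assumes T: "T \<in> bounded_opers UNIV"
  shows "adj T \<in> bounded_opers UNIV"
proof -
  obtain K where K: "0 \<le> K" "\<And>x. x \<in> ell2 UNIV \<Longrightarrow> ell2_norm UNIV (T x) \<le> K * ell2_norm UNIV x"
    using oper_bounded[OF T] by blast
  show ?thesis unfolding adj_def
  proof (rule bounded_opersI)
    fix x :: "'a \<Rightarrow> complex" assume x: "x \<in> ell2 UNIV"
    note b = ell2_bounded_sums[OF adj_partial_sums_le[OF T x K]]
    show "(\<lambda>k. ell2_inner UNIV x (T (ell2_basis k))) \<in> ell2 UNIV" by (rule b)
    show "ell2_norm UNIV (\<lambda>k. ell2_inner UNIV x (T (ell2_basis k))) \<le> K * ell2_norm UNIV x"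
      by (rule power2_le_imp_le[OF b(2)]) (auto intro: mult_nonneg_nonneg K)
  qed (simp add: inner_lincomb_left oper_in[OF T basis_ell2])
qed

lemma adj_inner:
  assumes T: "T \<in> bounded_opers UNIV" and x: "x \<in> ell2 UNIV" and y: "y \<in> ell2 UNIV"
  shows "ell2_inner UNIV x (adj T y) = ell2_inner UNIV (T x) y"
proof -
  have "ell2_inner UNIV x (adj T y) = (\<Sum>\<^sub>\<infinity>k. x k * ell2_inner UNIV (T (ell2_basis k)) y)"
    unfolding ell2_inner_def[of UNIV x] using y
    by (simp add: adj_def) (subst inner_commute, simp)
  also have "\<dots> = ell2_inner UNIV (T x) y" by (rule infsumI[OF oper_matrix_has_sum[OF T x y]])
  finally show ?thesis .
qed

lemma adj_inner_left:
  assumes T: "T \<in> bounded_opers UNIV" and x: "x \<in> ell2 UNIV" and y: "y \<in> ell2 UNIV"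
  shows "ell2_inner UNIV (adj T x) y = ell2_inner UNIV x (T y)"
  by (subst (1 2) inner_commute) (simp add: adj_inner assms)

text \<open>
  States are real only on hermitian operators, so arguments by order split \<open>T\<close> as \<open>Re T + \<i> Im T\<close>.
\<close>

definition re_part :: "'i oper \<Rightarrow> 'i oper" where
  "re_part T = oper_lincomb UNIV (1/2) T (1/2) (adj T)"
definition im_part :: "'i oper \<Rightarrow> 'i oper" where
  "im_part T = oper_lincomb UNIV (- \<i>/2) T (\<i>/2) (adj T)"

lemma parts_in:
  assumes "T \<in> bounded_opers UNIV"
  shows "re_part T \<in> bounded_opers UNIV" "im_part T \<in> bounded_opers UNIV"
  unfolding re_part_def im_part_def by (intro lincomb_in adj_in assms)+

lemma parts_sum:
  assumes "T \<in> bounded_opers UNIV"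
  shows "oper_lincomb UNIV 1 (re_part T) \<i> (im_part T) = T"
proof (rule oper_eqI)
  show "T \<in> extensional (ell2 UNIV)" by (rule oper_extensional[OF assms])
  show "oper_lincomb UNIV 1 (re_part T) \<i> (im_part T) \<in> extensional (ell2 UNIV)"
    by (simp add: oper_lincomb_def)
  show "oper_lincomb UNIV 1 (re_part T) \<i> (im_part T) x = T x" if "x \<in> ell2 UNIV" for x
    by (simp add: lincomb_apply that re_part_def im_part_def field_simps fun_eq_iff)
qed

definition hermitian :: "'i oper \<Rightarrow> bool" where
  "hermitian T \<longleftrightarrow> T \<in> bounded_opers UNIV \<and>
    (\<forall>x\<in>ell2 UNIV. \<forall>y\<in>ell2 UNIV. ell2_inner UNIV (T x) y = ell2_inner UNIV x (T y))"

lemma parts_hermitian: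
  assumes T: "T \<in> bounded_opers UNIV"
  shows "hermitian (re_part T)" "hermitian (im_part T)"
  using parts_in[OF T]
  by (auto simp: hermitian_def re_part_def im_part_def inner_oper_lincomb[OF T adj_in[OF T]]
    adj_inner[OF T] adj_inner_left[OF T])

lemma hermitian_real: "hermitian T \<Longrightarrow> x \<in> ell2 UNIV \<Longrightarrow> ell2_inner UNIV (T x) x \<in> \<real>"
  unfolding hermitian_def by (metis Reals_cnj_iff inner_commute)

lemma adj_entry: "T \<in> bounded_opers UNIV \<Longrightarrow> adj T (ell2_basis k) j = cnj (T (ell2_basis j) k)"
  by (simp add: adj_def basis_ell2 inner_commute[of _ "ell2_basis k"] inner_basis_right)

section \<open>States\<close>

text \<open>
  This covers both the diagonal and the full algebra, so that the facts about states below apply to a state of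
  the diagonal and to its extensions alike.
\<close>

definition oper_space :: "'i oper set \<Rightarrow> bool" where
  "oper_space R \<longleftrightarrow> diagonal_opers UNIV \<subseteq> R \<and> R \<subseteq> bounded_opers UNIV \<and>
     (\<forall>S\<in>R. \<forall>T\<in>R. \<forall>a b. oper_lincomb UNIV a S b T \<in> R)"

lemma oper_space_diagonal: "oper_space (diagonal_opers UNIV)"
  by (auto simp: oper_space_def diagonal_subset_bounded diagonal_lincomb)

lemma oper_space_bounded: "oper_space (bounded_opers UNIV)"
  by (auto simp: oper_space_def diagonal_subset_bounded lincomb_in)

lemma oper_spaceD:
  assumes "oper_space R"
  shows "T \<in> R \<Longrightarrow> T \<in> bounded_opers UNIV" "T \<in> diagonal_opers UNIV \<Longrightarrow> T \<in> R"
    "S \<in> R \<Longrightarrow> T \<in> R \<Longrightarrow> oper_lincomb UNIV a S b T \<in> R"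
  using assms by (auto simp: oper_space_def)

lemma state_lincomb: "g \<in> states I R \<Longrightarrow> S \<in> R \<Longrightarrow> T \<in> R \<Longrightarrow>
    g (oper_lincomb I a S b T) = a * g S + b * g T"
  by (auto simp: states_def)

lemma state_id: "g \<in> states I R \<Longrightarrow> g (oper_id I) = 1"
  by (auto simp: states_def)

lemma state_positive: "g \<in> states I R \<Longrightarrow> T \<in> R \<Longrightarrow> positive_oper I T \<Longrightarrow> g T \<in> \<real>\<^sub>\<ge>\<^sub>0"
  by (auto simp: states_def)

lemma proj_positive: "positive_oper UNIV (proj A)"
  using proj_in[of A] diagonal_subset_bounded by (auto simp: positive_oper_def inner_proj)

lemma state_proj:
  assumes R: "oper_space R" and g: "g \<in> states UNIV R"
  shows "g (proj A) + g (proj (-A)) = 1" "g (proj A) \<in> \<real>\<^sub>\<ge>\<^sub>0" "Re (g (proj A)) \<le> 1"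
proof -
  show 1: "g (proj A) + g (proj (-A)) = 1" for A
    using state_lincomb[OF g oper_spaceD(2)[OF R proj_in] oper_spaceD(2)[OF R proj_in], of 1 A 1 "-A"]
    by (simp add: proj_compl state_id[OF g])
  show 2: "g (proj A) \<in> \<real>\<^sub>\<ge>\<^sub>0" for A
    by (rule state_positive[OF g oper_spaceD(2)[OF R proj_in] proj_positive])
  have "Re (g (proj A)) + Re (g (proj (-A))) = 1" using 1[of A] by (metis one_complex.sel(1) plus_complex.sel(1))
  then show "Re (g (proj A)) \<le> 1" using 2[of "-A"] by (auto simp: complex_nonneg_Reals_iff)
qed

text \<open>
  The hypothesis says that \<open>a Q\<^sub>A + C Q\<^bsub>-A\<^esub> \<plusminus> H\<close> is positive, and \<open>g\<close> vanishes on \<open>Q\<^bsub>-A\<^esub>\<close>,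
  so only the term with \<open>a\<close> survives.
\<close>

lemma state_le_of_form_le:
  assumes R: "oper_space R" and g: "g \<in> states UNIV R" and H: "H \<in> R"
    and re: "\<And>x. x \<in> ell2 UNIV \<Longrightarrow> ell2_inner UNIV (H x) x \<in> \<real>"
    and bd: "\<And>x. x \<in> ell2 UNIV \<Longrightarrow>
      cmod (ell2_inner UNIV (H x) x) \<le> a * sqn (clip A x) + C * sqn (clip (-A) x)"
    and A: "g (proj A) = 1"
  shows "cmod (g H) \<le> a"
proof -
  note P = oper_spaceD(2)[OF R proj_in]
  have *: "Im (g H) = 0 \<and> 0 \<le> a + s * Re (g H)" if s: "s = 1 \<or> s = - 1" for s :: real
  proof -
    define W where "W = oper_lincomb UNIV (of_real a) (proj A) (of_real C) (proj (-A))"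
    have W: "W \<in> R" unfolding W_def by (intro oper_spaceD(3)[OF R] P)
    have "positive_oper UNIV (oper_lincomb UNIV 1 W (of_real s) H)"
      unfolding positive_oper_def
    proof (intro conjI ballI)
      show "oper_lincomb UNIV 1 W (of_real s) H \<in> bounded_opers UNIV"
        by (intro oper_spaceD(1)[OF R] oper_spaceD(3)[OF R] W H)
      fix x :: "'a \<Rightarrow> complex" assume x: "x \<in> ell2 UNIV"
      have "ell2_inner UNIV (oper_lincomb UNIV 1 W (of_real s) H x) x
        = of_real (a * sqn (clip A x) + C * sqn (clip (-A) x)) + of_real s * ell2_inner UNIV (H x) x"
        unfolding W_def
        by (simp add: inner_oper_lincomb(1) oper_spaceD(1)[OF R] oper_spaceD(3)[OF R] P H x inner_proj)
      then show "ell2_inner UNIV (oper_lincomb UNIV 1 W (of_real s) H x) x \<in> \<real>\<^sub>\<ge>\<^sub>0"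
        using re[OF x] bd[OF x] s abs_Re_le_cmod[of "ell2_inner UNIV (H x) x"]
        by (auto simp: complex_nonneg_Reals_iff complex_is_Real_iff)
    qed
    then have "g (oper_lincomb UNIV 1 W (of_real s) H) \<in> \<real>\<^sub>\<ge>\<^sub>0"
      by (intro state_positive[OF g] oper_spaceD(3)[OF R] W H)
    moreover have "g (proj (-A)) = 0" using state_proj(1)[OF R g, of A] A by simp
    then have "g W = of_real a" unfolding W_def using A by (simp add: state_lincomb[OF g P P])
    ultimately show ?thesis using s by (auto simp: state_lincomb[OF g W H] complex_nonneg_Reals_iff)
  qed
  have "cmod (g H) = \<bar>Re (g H)\<bar>" using *[of 1] by (simp add: cmod_eq_Re)
  then show ?thesis using *[of 1] *[of "-1"] by auto
qed

text \<open>
  Split \<open>x\<close> into \<open>u = clip A x\<close> and \<open>v\<close>. The cross terms are at most \<open>2 K \<parallel>u\<parallel> \<parallel>v\<parallel>\<close>, and the weighted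
  inequality between arithmetic and geometric mean moves nearly all of their cost to \<open>v\<close>.
\<close>

lemma form_block_bound:
  assumes H: "H \<in> bounded_opers UNIV" and \<delta>: "0 < \<delta>"
  shows "\<exists>C. \<forall>A. \<forall>x\<in>ell2 UNIV. cmod (ell2_inner UNIV (H x) x)
    \<le> cmod (ell2_inner UNIV (H (clip A x)) (clip A x)) + \<delta> * sqn (clip A x) + C * sqn (clip (-A) x)"
proof -
  obtain K where K: "0 \<le> K" "\<And>x. x \<in> ell2 UNIV \<Longrightarrow> ell2_norm UNIV (H x) \<le> K * ell2_norm UNIV x"
    using oper_bounded[OF H] by blast
  show ?thesis
  proof (intro exI allI ballI)
    fix A and x :: "'a \<Rightarrow> complex" assume x: "x \<in> ell2 UNIV"
    define u v p q where "u = clip A x" and "v = clip (-A) x" and "p = ell2_norm UNIV u" and "q = ell2_norm UNIV v"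
    have u: "u \<in> ell2 UNIV" and v: "v \<in> ell2 UNIV"
      unfolding u_def v_def by (auto simp: clip_ell2 x)
    have xuv: "x = (\<lambda>i. 1 * u i + 1 * v i)" by (auto simp: u_def v_def clip_def)
    have "ell2_inner UNIV (H x) x = ell2_inner UNIV (H u) u + ell2_inner UNIV (H u) v
        + (ell2_inner UNIV (H v) u + ell2_inner UNIV (H v) v)"
      by (subst (1 2) xuv)
        (simp only: oper_linear[OF H u(1) v] inner_lincomb_left inner_lincomb_right oper_in[OF H] u v
          ell2_lincomb[OF u(1) v], simp add: algebra_simps)
    also have "cmod \<dots> \<le> (cmod (ell2_inner UNIV (H u) u) + K * p * q) + (K * q * p + K * q * q)"
      unfolding p_def q_def
      by (intro norm_triangle_le add_mono order_refl u inner_oper_le[OF H _ _ K(2)] v)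
    also have "2 * (K * p * q) \<le> \<delta> * p\<^sup>2 + K\<^sup>2 / \<delta> * q\<^sup>2"
    proof -
      have "0 \<le> (\<delta> * p - K * q)\<^sup>2 / \<delta>" using \<delta> by simp
      also have "\<dots> = \<delta> * p\<^sup>2 + K\<^sup>2 / \<delta> * q\<^sup>2 - 2 * (K * p * q)"
        using \<delta> by (simp add: field_simps power2_eq_square)
      finally show ?thesis by simp
    qed
    then have "(cmod (ell2_inner UNIV (H u) u) + K * p * q) + (K * q * p + K * q * q)
        \<le> cmod (ell2_inner UNIV (H u) u) + \<delta> * p\<^sup>2 + (K + K\<^sup>2 / \<delta>) * q\<^sup>2"
      by (simp add: algebra_simps power2_eq_square)
    finally show "cmod (ell2_inner UNIV (H x) x) \<le> cmod (ell2_inner UNIV (H (clip A x)) (clip A x))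
        + \<delta> * sqn (clip A x) + (K + K\<^sup>2 / \<delta>) * sqn (clip (-A) x)"
      by (simp add: p_def q_def u_def v_def)
  qed
qed

text \<open>
  A state with \<open>g Q\<^sub>A = 1\<close> sees only the corner of \<open>H\<close> on \<open>A\<close>. This replaces the Cauchy--Schwarz argument
  \<open>g H = g (Q\<^sub>A H Q\<^sub>A)\<close>.
\<close>

lemma state_le_of_form_le_on:
  assumes R: "oper_space R" and g: "g \<in> states UNIV R" and H: "H \<in> R" and h: "hermitian H"
    and bd: "\<And>x. x \<in> ell2 UNIV \<Longrightarrow> clip A x = x \<Longrightarrow> cmod (ell2_inner UNIV (H x) x) \<le> a * sqn x"
    and A: "g (proj A) = 1"
  shows "cmod (g H) \<le> a"
proof (rule field_le_epsilon)
  fix \<delta> :: real assume "0 < \<delta>"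
  then obtain C where C: "\<And>B x. x \<in> ell2 UNIV \<Longrightarrow> cmod (ell2_inner UNIV (H x) x)
    \<le> cmod (ell2_inner UNIV (H (clip B x)) (clip B x)) + \<delta> * sqn (clip B x) + C * sqn (clip (-B) x)"
    using form_block_bound[OF oper_spaceD(1)[OF R H]] by metis
  show "cmod (g H) \<le> a + \<delta>"
  proof (rule state_le_of_form_le[OF R g H hermitian_real[OF h] _ A])
    fix x :: "'a \<Rightarrow> complex" assume x: "x \<in> ell2 UNIV"
    have "clip A (clip A x) = clip A x" by (auto simp: clip_def)
    then have "cmod (ell2_inner UNIV (H (clip A x)) (clip A x)) \<le> a * sqn (clip A x)"
      by (intro bd clip_ell2 x)
    then show "cmod (ell2_inner UNIV (H x) x) \<le> (a + \<delta>) * sqn (clip A x) + C * sqn (clip (-A) x)"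
      using C[OF x, of A] by (simp add: distrib_right)
  qed
qed

lemma diag_hermitian:
  assumes "\<And>i. d i \<in> \<real>" "diag d \<in> bounded_opers UNIV"
  shows "hermitian (diag d)"
  unfolding hermitian_def
  using assms by (auto simp: diag_apply ell2_inner_def Reals_cnj_iff intro!: infsum_cong)

text \<open>
  Along \<open>U\<close> the diagonal entries converge to some \<open>z\<close>, so \<open>T - z\<close> is small on a member \<open>B\<close> of \<open>U\<close>, and \<open>g\<close>
  sees only that corner. In particular the values on projections determine the state on the diagonal.
\<close>

lemma state_eq_ultralimit:
  fixes U :: "'i filter"
  assumes U: "ultrafilter U" and R: "oper_space R" and g: "g \<in> states UNIV R"
    and one: "\<And>B. eventually (\<lambda>i. i \<in> B) U \<Longrightarrow> g (proj B) = 1"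
    and T: "T \<in> diagonal_opers UNIV"
  shows "((\<lambda>k. T (ell2_basis k) k) \<longlongrightarrow> g T) U"
proof -
  obtain d K where Td: "T = diag d" and dK: "\<And>i. cmod (d i) \<le> K" using diagonalE[OF T] by metis
  obtain z where z: "(d \<longlongrightarrow> z) U" using ultrafilter_bounded_limit[OF U, of d K] dK by auto
  have "cmod (g T - z) \<le> 0 + \<epsilon>" if "0 < \<epsilon>" for \<epsilon>
  proof -
    define B where "B = {i. cmod (d i - z) \<le> \<epsilon> / 2}"
    have "eventually (\<lambda>i. dist (d i) z < \<epsilon> / 2) U" using that z by (intro tendstoD) auto
    then have "eventually (\<lambda>i. i \<in> B) U" by eventually_elim (auto simp: B_def dist_norm)
    then have gB: "g (proj B) = 1" by (rule one)
    have small: "cmod (g (diag h)) \<le> \<epsilon> / 2" "diag h \<in> R"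
      if h: "\<And>i. h i \<in> \<real>" "\<And>i. cmod (h i) \<le> cmod (d i - z)" for h
    proof -
      have "cmod (h i) \<le> K + cmod z" for i
        using h(2)[of i] norm_triangle_ineq4[of "d i" z] dK[of i] by linarith
      then have D: "diag h \<in> diagonal_opers UNIV" by (rule diag_in)
      show hR: "diag h \<in> R" by (rule oper_spaceD(2)[OF R D])
      show "cmod (g (diag h)) \<le> \<epsilon> / 2"
      proof (rule state_le_of_form_le_on[OF R g hR _ _ gB])
        show "hermitian (diag h)" using D diagonal_subset_bounded h(1) by (intro diag_hermitian) auto
        fix x :: "'i \<Rightarrow> complex" assume x: "x \<in> ell2 UNIV" "clip B x = x"
        have "diag h x = (\<lambda>i. (if i \<in> B then h i else 0) * x i)"
          unfolding diag_apply[OF x(1)] by (subst (1 2) x(2)[symmetric]) (auto simp: clip_def)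
        moreover have hB: "cmod (if i \<in> B then h i else 0) \<le> \<epsilon> / 2" for i
          using h(2)[of i] \<open>0 < \<epsilon>\<close> by (auto simp: B_def)
        ultimately have "ell2_norm UNIV (diag h x) \<le> \<epsilon> / 2 * ell2_norm UNIV x"
          using ell2_mult(2)[OF x(1) hB] by simp
        moreover have "diag h x \<in> ell2 UNIV" using D diagonal_subset_bounded x(1) oper_in by blast
        ultimately show "cmod (ell2_inner UNIV (diag h x) x) \<le> \<epsilon> / 2 * sqn x"
          using inner_product_summable(2)[of "diag h x" x] x(1)
            mult_right_mono[of _ _ "ell2_norm UNIV x"] by (fastforce simp: power2_eq_square mult.assoc[symmetric])
      qed
    qed
    define h1 h2 where "h1 i = complex_of_real (Re (d i - z))" and "h2 i = complex_of_real (Im (d i - z))" for i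
    have h1: "cmod (g (diag h1)) \<le> \<epsilon> / 2" "diag h1 \<in> R"
      and h2: "cmod (g (diag h2)) \<le> \<epsilon> / 2" "diag h2 \<in> R"
      by (rule small; use abs_Re_le_cmod abs_Im_le_cmod in \<open>auto simp: h1_def h2_def simp del: minus_complex.sel\<close>)+
    have "T = oper_lincomb UNIV 1 (oper_lincomb UNIV 1 (diag h1) \<i> (diag h2)) z (oper_id UNIV)"
      unfolding Td id_diag diag_lincomb by (intro arg_cong[where f = diag]) (auto simp: complex_eq_iff h1_def h2_def)
    then have "g T = g (diag h1) + \<i> * g (diag h2) + z"
      by (simp add: state_lincomb[OF g] oper_spaceD(3)[OF R] h1 h2 oper_spaceD(2)[OF R id_in] state_id[OF g])
    then have "cmod (g T - z) \<le> cmod (g (diag h1)) + cmod (g (diag h2))"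
      using norm_triangle_ineq[of "g (diag h1)" "\<i> * g (diag h2)"] by (simp add: norm_mult)
    then show ?thesis using h1 h2 by linarith
  qed
  then have "cmod (g T - z) \<le> 0" by (rule field_le_epsilon)
  then show ?thesis using z by (simp add: Td diag_entry)
qed

subsection \<open>Limits of vector states\<close>

text \<open>
  A limit along \<open>W\<close> of the vector states \<open>T \<mapsto> \<langle>T x, x\<rangle>\<close>. With the ultrafilter on vectors, both states needed for non-uniqueness
  have this form.
\<close>

definition vector_state :: "('i \<Rightarrow> complex) filter \<Rightarrow> 'i oper set \<Rightarrow> 'i oper \<Rightarrow> complex" where
  "vector_state W R = (\<lambda>T\<in>R. Lim W (\<lambda>x. ell2_inner UNIV (T x) x))"

lemma vector_state_tendsto:
  assumes W: "ultrafilter W" and unit: "eventually (\<lambda>x. x \<in> ell2 UNIV \<and> ell2_norm UNIV x = 1) W"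
    and R: "oper_space R" and T: "T \<in> R"
  shows "((\<lambda>x. ell2_inner UNIV (T x) x) \<longlongrightarrow> vector_state W R T) W"
proof -
  have Tb: "T \<in> bounded_opers UNIV" by (rule oper_spaceD(1)[OF R T])
  obtain K where K: "0 \<le> K" "\<And>x. x \<in> ell2 UNIV \<Longrightarrow> ell2_norm UNIV (T x) \<le> K * ell2_norm UNIV x"
    using oper_bounded[OF Tb] by blast
  have "eventually (\<lambda>x. cmod (ell2_inner UNIV (T x) x) \<le> K) W"
    using unit
  proof eventually_elim
    case (elim x)
    then show ?case using inner_oper_le[OF Tb, of x x K] K(2) by auto
  qed
  then obtain l where l: "((\<lambda>x. ell2_inner UNIV (T x) x) \<longlongrightarrow> l) W"
    using ultrafilter_bounded_limit[OF W] by metis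
  then show ?thesis using T ultrafilterD(1)[OF W] by (simp add: vector_state_def tendsto_Lim)
qed

lemma vector_state_eqI:
  assumes W: "ultrafilter W" and unit: "eventually (\<lambda>x. x \<in> ell2 UNIV \<and> ell2_norm UNIV x = 1) W"
    and R: "oper_space R" and T: "T \<in> R"
    and l: "((\<lambda>x. ell2_inner UNIV (T x) x) \<longlongrightarrow> l) W"
  shows "vector_state W R T = l"
  by (rule tendsto_unique[OF ultrafilterD(1)[OF W] vector_state_tendsto[OF W unit R T] l])

lemma vector_state_state:
  assumes W: "ultrafilter W" and unit: "eventually (\<lambda>x. x \<in> ell2 UNIV \<and> ell2_norm UNIV x = 1) W"
    and R: "oper_space R"
  shows "vector_state W R \<in> states UNIV R"
  unfolding states_def
proof (intro CollectI conjI ballI allI impI)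
  show "vector_state W R \<in> extensional R" by (simp add: vector_state_def)
next
  fix S T a b assume S: "S \<in> R" and T: "T \<in> R"
  show "vector_state W R (oper_lincomb UNIV a S b T) = a * vector_state W R S + b * vector_state W R T"
  proof (rule vector_state_eqI[OF W unit R oper_spaceD(3)[OF R S T]])
    have "((\<lambda>x. a * ell2_inner UNIV (S x) x + b * ell2_inner UNIV (T x) x)
        \<longlongrightarrow> a * vector_state W R S + b * vector_state W R T) W"
      by (intro tendsto_intros vector_state_tendsto[OF W unit R] S T)
    moreover have "eventually (\<lambda>x. a * ell2_inner UNIV (S x) x + b * ell2_inner UNIV (T x) x
        = ell2_inner UNIV (oper_lincomb UNIV a S b T x) x) W"
      using unit by eventually_elim (simp add: inner_oper_lincomb oper_spaceD(1)[OF R] S T)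
    ultimately show "((\<lambda>x. ell2_inner UNIV (oper_lincomb UNIV a S b T x) x)
        \<longlongrightarrow> a * vector_state W R S + b * vector_state W R T) W"
      by (rule Lim_transform_eventually)
  qed
next
  show "vector_state W R (oper_id UNIV) = 1"
  proof (rule vector_state_eqI[OF W unit R oper_spaceD(2)[OF R id_in]], rule tendsto_eventually)
    show "eventually (\<lambda>x. ell2_inner UNIV (oper_id UNIV x) x = 1) W"
      using unit by eventually_elim (simp add: oper_id_def inner_self)
  qed
next
  fix T assume T: "T \<in> R" and pos: "positive_oper UNIV T"
  show "vector_state W R T \<in> \<real>\<^sub>\<ge>\<^sub>0"
  proof (rule Lim_in_closed_set[OF closed_nonneg_Reals_complex _ ultrafilterD(1)[OF W] vector_state_tendsto[OF W unit R T]])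
    show "eventually (\<lambda>x. ell2_inner UNIV (T x) x \<in> \<real>\<^sub>\<ge>\<^sub>0) W"
      using unit by eventually_elim (use pos in \<open>auto simp: positive_oper_def\<close>)
  qed
qed

subsection \<open>Pure states of the diagonal\<close>

lemma basis_vectors_ultrafilter:
  assumes "ultrafilter U"
  shows "ultrafilter (filtermap ell2_basis U)"
    "eventually (\<lambda>x. x \<in> ell2 UNIV \<and> ell2_norm UNIV x = 1) (filtermap ell2_basis U)"
  using assms by (auto simp: ultrafilter_filtermap eventually_filtermap basis_ell2 basis_norm)

lemma basis_state_proj:
  assumes U: "ultrafilter U" and R: "oper_space R" and B: "eventually (\<lambda>i. i \<in> B) U"
  shows "vector_state (filtermap ell2_basis U) R (proj B) = 1"
proof (rule vector_state_eqI[OF basis_vectors_ultrafilter[OF U] R oper_spaceD(2)[OF R proj_in]], rule tendsto_eventually)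
  show "eventually (\<lambda>x. ell2_inner UNIV (proj B x) x = 1) (filtermap ell2_basis U)"
    unfolding eventually_filtermap using B
    by eventually_elim (auto simp: inner_basis_right proj_def diag_entry)
qed

text \<open>
  In a proper convex combination equal to \<open>f\<close>, both members take the value 1 on each projection \<open>Q\<^sub>B\<close> with
  \<open>B\<close> in \<open>U\<close>, because neither can exceed 1; by \<open>state_eq_ultralimit\<close> they coincide with \<open>f\<close>.
\<close>

lemma ultralimit_state_pure:
  assumes U: "ultrafilter U"
  shows "vector_state (filtermap ell2_basis U) (diagonal_opers UNIV) \<in> pure_states UNIV (diagonal_opers UNIV)"
proof -
  let ?D = "diagonal_opers UNIV" and ?f = "vector_state (filtermap ell2_basis U) (diagonal_opers UNIV)"
  note R = oper_space_diagonal
  have f: "?f \<in> states UNIV ?D" by (rule vector_state_state[OF basis_vectors_ultrafilter[OF U] R])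
  have eq: "g = ?f" if g: "g \<in> states UNIV ?D" and one: "\<And>B. eventually (\<lambda>i. i \<in> B) U \<Longrightarrow> g (proj B) = 1" for g
  proof (rule extensionalityI)
    show "g \<in> extensional ?D" "?f \<in> extensional ?D" using f g by (auto simp: states_def)
    fix T assume T: "T \<in> (?D :: 'a oper set)"
    show "g T = ?f T"
      by (rule tendsto_unique[OF ultrafilterD(1)[OF U]
          state_eq_ultralimit[OF U R g one T] state_eq_ultralimit[OF U R f basis_state_proj[OF U R] T]])
  qed
  show ?thesis unfolding pure_states_def
  proof (intro CollectI conjI ballI allI impI f)
    fix g h and t :: real
    assume g: "g \<in> states UNIV ?D" and h: "h \<in> states UNIV ?D"
      and t: "0 < t \<and> t < 1 \<and> ?f = (\<lambda>T\<in>?D. of_real t * g T + of_real (1 - t) * h T)"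
    have "g (proj B) = 1 \<and> h (proj B) = 1" if B: "eventually (\<lambda>i. i \<in> B) U" for B
    proof -
      have "1 = of_real t * g (proj B) + of_real (1 - t) * h (proj B)"
        using basis_state_proj[OF U R B] t proj_in[of B] by (metis (no_types, lifting) restrict_apply')
      then have "1 = t * Re (g (proj B)) + (1 - t) * Re (h (proj B))"
        by (metis Re_complex_of_real of_real_1 plus_complex.sel(1) Re_complex_of_real times_complex.sel(1) Im_complex_of_real mult_zero_left diff_zero)
      moreover have "Re (g (proj B)) \<le> 1" "Re (h (proj B)) \<le> 1"
        by (rule state_proj(3)[OF R g] state_proj(3)[OF R h])+
      ultimately have "Re (g (proj B)) = 1 \<and> Re (h (proj B)) = 1"
        using t mult_left_mono[of "Re (g (proj B))" 1 t] mult_left_mono[of "Re (h (proj B))" 1 "1 - t"]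
        by (smt (verit) mult_cancel_left1 mult_left_le)
      then show ?thesis using state_proj(2)[OF R g, of B] state_proj(2)[OF R h, of B]
        by (auto simp: complex_nonneg_Reals_iff complex_eq_iff)
    qed
    then show "g = ?f" "h = ?f" using eq[OF g] eq[OF h] by auto
  qed
qed

text \<open>
  On diagonal operators this is multiplication by \<open>Q\<^sub>A\<close>.
\<close>

definition compress :: "'i set \<Rightarrow> 'i oper \<Rightarrow> 'i oper" where
  "compress A T = (\<lambda>x\<in>ell2 UNIV. T (clip A x))"

lemma compress_diag: "compress A (diag d) = diag (\<lambda>i. (if i \<in> A then 1 else 0) * d i)"
  unfolding compress_def diag_def[of "\<lambda>i. (if i \<in> A then 1 else 0) * d i"]
  by (rule restrict_ext) (simp add: diag_apply clip_ell2, auto simp: clip_def)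

lemma compress_in: "T \<in> diagonal_opers UNIV \<Longrightarrow> compress A T \<in> diagonal_opers UNIV"
  by (erule diagonalE, simp only: compress_diag) (auto intro!: diag_in)

lemma compress_lincomb: "oper_lincomb UNIV a (compress A S) b (compress A T) = compress A (oper_lincomb UNIV a S b T)"
  by (auto simp: oper_lincomb_def compress_def fun_eq_iff clip_ell2)

lemma compress_positive:
  assumes "T \<in> diagonal_opers UNIV" "positive_oper UNIV T"
  shows "positive_oper UNIV (compress A T)"
  unfolding positive_oper_def
proof (intro conjI ballI)
  show "compress A T \<in> bounded_opers UNIV" using compress_in[OF assms(1)] diagonal_subset_bounded by auto
  fix x :: "'a \<Rightarrow> complex" assume x: "x \<in> ell2 UNIV"
  obtain d where T: "T = diag d" using diagonalE[OF assms(1)] by metis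
  have "ell2_inner UNIV (compress A T x) x = ell2_inner UNIV (T (clip A x)) (clip A x)"
    unfolding compress_def ell2_inner_def T using x
    by (simp add: diag_apply clip_ell2, intro infsum_cong) (auto simp: clip_def)
  then show "ell2_inner UNIV (compress A T x) x \<in> \<real>\<^sub>\<ge>\<^sub>0"
    using assms(2) clip_ell2[OF x] by (simp add: positive_oper_def)
qed

lemma compress_id: "compress A (oper_id UNIV) = proj A"
  unfolding id_diag compress_diag proj_def by simp

lemma compress_split: "T \<in> diagonal_opers UNIV \<Longrightarrow> oper_lincomb UNIV 1 (compress A T) 1 (compress (-A) T) = T"
  by (erule diagonalE) (auto simp: compress_diag diag_lincomb intro!: arg_cong[where f = diag])

lemma compress_state:
  fixes A :: "'a set"
  assumes f: "f \<in> states UNIV (diagonal_opers UNIV)" and c: "f (proj A) = of_real c" "0 < c"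
  shows "(\<lambda>T\<in>diagonal_opers UNIV. f (compress A T) / of_real c) \<in> states UNIV (diagonal_opers UNIV)"
  unfolding states_def
proof (intro CollectI conjI ballI allI impI)
  fix T :: "'a oper" assume T: "T \<in> diagonal_opers UNIV" "positive_oper UNIV T"
  have "f (compress A T) \<in> \<real>\<^sub>\<ge>\<^sub>0"
    by (intro state_positive[OF f] compress_in compress_positive T)
  then show "(\<lambda>T\<in>diagonal_opers UNIV. f (compress A T) / of_real c) T \<in> \<real>\<^sub>\<ge>\<^sub>0"
    using T c by (simp add: complex_nonneg_Reals_iff)
qed (use c in \<open>simp_all add: diagonal_lincomb compress_lincomb[symmetric] state_lincomb[OF f] compress_in
  id_in compress_id add_divide_distrib\<close>)

text \<open>
  If \<open>c = f Q\<^sub>A\<close> lay strictly between 0 and 1, then \<open>f\<close> would be the combination with weights \<open>c\<close> and \<open>1 - c\<close> of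
  its normalised restrictions to \<open>A\<close> and to the complement, and these differ on \<open>Q\<^sub>A\<close>.
\<close>

lemma pure_state_proj:
  assumes f: "f \<in> pure_states UNIV (diagonal_opers UNIV)"
  shows "f (proj A) = 0 \<or> f (proj A) = 1"
proof (rule ccontr)
  let ?D = "diagonal_opers UNIV :: 'a oper set"
  assume n: "\<not> ?thesis"
  note R = oper_space_diagonal
  have fs: "f \<in> states UNIV ?D" using f by (auto simp: pure_states_def)
  define c where "c = Re (f (proj A))"
  have fc: "f (proj A) = of_real c" "0 \<le> c" and c1: "c \<le> 1"
    using state_proj(2,3)[OF R fs, of A] by (auto simp: c_def complex_nonneg_Reals_iff complex_eq_iff)
  then have c: "0 < c" "c < 1" using n by (auto simp: less_le)
  have fc': "f (proj (-A)) = of_real (1 - c)"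
    using state_proj(1)[OF R fs, of A] fc by (simp add: eq_diff_eq add.commute)
  define g where "g = (\<lambda>T\<in>?D. f (compress A T) / of_real c)"
  define h where "h = (\<lambda>T\<in>?D. f (compress (-A) T) / of_real (1 - c))"
  have "g \<in> states UNIV ?D" "h \<in> states UNIV ?D"
    unfolding g_def h_def using c compress_state[OF fs fc(1)] compress_state[OF fs fc'] by auto
  moreover have "f = (\<lambda>T\<in>?D. of_real c * g T + of_real (1 - c) * h T)"
  proof (rule extensionalityI)
    show "f \<in> extensional ?D" using fs by (auto simp: states_def)
    fix T assume T: "T \<in> ?D"
    have "f T = f (compress A T) + f (compress (-A) T)"
      using state_lincomb[OF fs compress_in[OF T] compress_in[OF T], of 1 A 1 "-A"] compress_split[OF T] by simp
    then show "f T = (\<lambda>T\<in>?D. of_real c * g T + of_real (1 - c) * h T) T"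
      using T c by (simp add: g_def h_def del: of_real_diff)
  qed simp
  ultimately have "g = f" using f c unfolding pure_states_def by blast
  moreover have "compress A (proj A) = proj A"
    unfolding proj_def compress_diag by (intro arg_cong[where f = diag]) auto
  ultimately have "f (proj A) = f (proj A) / of_real c" by (metis g_def proj_in restrict_apply')
  then show False using fc c by (simp add: field_simps flip: of_real_mult)
qed

lemma pure_state_partition:
  assumes f: "f \<in> pure_states UNIV (diagonal_opers UNIV)" and C: "finite C" "\<And>i. c i \<in> C"
  shows "\<exists>l\<in>C. f (proj {i. c i = l}) = 1"
proof (rule ccontr)
  let ?D = "diagonal_opers UNIV :: 'a oper set"
  assume "\<not> ?thesis"
  then have 0: "\<And>l. l \<in> C \<Longrightarrow> f (proj {i. c i = l}) = 0" using pure_state_proj[OF f] by blast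
  have fs: "f \<in> states UNIV ?D" using f by (auto simp: pure_states_def)
  have "L \<subseteq> C \<Longrightarrow> f (proj {i. c i \<in> L}) = 0" if "finite L" for L
    using that
  proof (induction L)
    case empty
    have "proj {i. c i \<in> {}} = oper_lincomb UNIV 0 (proj {}) 0 (proj {})"
      unfolding proj_def diag_lincomb by (intro arg_cong[where f = diag]) auto
    then show ?case using state_lincomb[OF fs proj_in proj_in, of 0 "{}" 0 "{}"] by simp
  next
    case (insert l L)
    have "proj {i. c i \<in> insert l L} = oper_lincomb UNIV 1 (proj {i. c i = l}) 1 (proj {i. c i \<in> L})"
      unfolding proj_def diag_lincomb using insert.hyps by (intro arg_cong[where f = diag]) auto
    then show ?case using insert 0 state_lincomb[OF fs proj_in proj_in] by simp
  qed
  then have "f (proj {i. c i \<in> C}) = 0" using C by blast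
  moreover have "proj {i. c i \<in> C} = oper_id UNIV" using C by (simp add: proj_def id_diag)
  ultimately show False using state_id[OF fs] by simp
qed

subsection \<open>The canonical extension\<close>

definition diag_part :: "'i oper \<Rightarrow> 'i oper" where
  "diag_part T = diag (\<lambda>k. T (ell2_basis k) k)"

lemma diag_part_in:
  assumes T: "T \<in> bounded_opers UNIV"
  shows "diag_part T \<in> diagonal_opers UNIV"
proof -
  obtain K where K: "0 \<le> K" "\<And>x. x \<in> ell2 UNIV \<Longrightarrow> ell2_norm UNIV (T x) \<le> K * ell2_norm UNIV x"
    using oper_bounded[OF T] by blast
  have "cmod (T (ell2_basis k) k) \<le> K" for k
    using ell2_component_le[OF oper_in[OF T basis_ell2], of k k] K(2)[OF basis_ell2, of k]
    by (simp add: basis_norm)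
  then show ?thesis unfolding diag_part_def by (rule diag_in)
qed

lemma diag_part_diag: "T \<in> diagonal_opers UNIV \<Longrightarrow> diag_part T = T"
  by (erule diagonalE) (simp add: diag_part_def diag_entry)

text \<open>
  Passing to the diagonal part is linear, fixes the diagonal, and preserves positivity since the diagonal entries
  are the values \<open>\<langle>T e\<^sub>k, e\<^sub>k\<rangle>\<close>.
\<close>

lemma canonical_extension:
  assumes f: "f \<in> states UNIV (diagonal_opers UNIV)"
  shows "(\<lambda>T\<in>bounded_opers UNIV. f (diag_part T)) \<in> states UNIV (bounded_opers UNIV)"
    and "restrict (\<lambda>T\<in>bounded_opers UNIV. f (diag_part T)) (diagonal_opers UNIV) = f"
proof -
  have [simp]: "oper_id UNIV \<in> bounded_opers UNIV" using id_in diagonal_subset_bounded by blast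
  show "(\<lambda>T\<in>bounded_opers UNIV. f (diag_part T)) \<in> states UNIV (bounded_opers UNIV)"
    unfolding states_def
  proof (intro CollectI conjI ballI allI impI)
    fix S T :: "'a oper" and a b assume S: "S \<in> bounded_opers UNIV" and T: "T \<in> bounded_opers UNIV"
    have "diag_part (oper_lincomb UNIV a S b T) = oper_lincomb UNIV a (diag_part S) b (diag_part T)"
      by (simp add: diag_part_def diag_lincomb lincomb_apply basis_ell2)
    then show "(\<lambda>T\<in>bounded_opers UNIV. f (diag_part T)) (oper_lincomb UNIV a S b T) =
       a * (\<lambda>T\<in>bounded_opers UNIV. f (diag_part T)) S + b * (\<lambda>T\<in>bounded_opers UNIV. f (diag_part T)) T"
      using S T by (simp add: lincomb_in state_lincomb[OF f] diag_part_in)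
  next
    fix T :: "'a oper" assume T: "T \<in> bounded_opers UNIV" and pos: "positive_oper UNIV T"
    have d: "T (ell2_basis k) k \<in> \<real>\<^sub>\<ge>\<^sub>0" for k
      using pos basis_ell2[of k] unfolding positive_oper_def by (metis inner_basis_right)
    have "positive_oper UNIV (diag_part T)"
      unfolding positive_oper_def
    proof (intro conjI ballI)
      show "diag_part T \<in> bounded_opers UNIV" using diag_part_in[OF T] diagonal_subset_bounded by blast
      fix x :: "'a \<Rightarrow> complex" assume x: "x \<in> ell2 UNIV"
      have "ell2_inner UNIV (diag_part T x) x
          = (\<Sum>\<^sub>\<infinity>k. of_real (Re (T (ell2_basis k) k) * (cmod (x k))\<^sup>2))"
        unfolding diag_part_def inner_diag[OF x]
        by (rule infsum_cong) (use d in \<open>auto simp: complex_nonneg_Reals_iff complex_eq_iff\<close>)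
      also have "\<dots> = of_real (\<Sum>\<^sub>\<infinity>k. Re (T (ell2_basis k) k) * (cmod (x k))\<^sup>2)"
      proof (rule infsumI, rule has_sum_of_real, rule has_sum_infsum)
        obtain K where K: "\<And>k. cmod (T (ell2_basis k) k) \<le> K"
          using diagonalE[OF diag_part_in[OF T]] by (metis diag_entry diag_part_def)
        show "(\<lambda>k. Re (T (ell2_basis k) k) * (cmod (x k))\<^sup>2) summable_on UNIV"
        proof (rule summable_on_comparison_test)
          show "(\<lambda>k. K * (cmod (x k))\<^sup>2) summable_on UNIV"
            using x by (intro summable_on_cmult_right) (simp add: ell2_UNIV)
          show "Re (T (ell2_basis k) k) * (cmod (x k))\<^sup>2 \<le> K * (cmod (x k))\<^sup>2" for k
            by (rule mult_right_mono) (use order_trans[OF complex_Re_le_cmod K] in auto)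
          show "0 \<le> Re (T (ell2_basis k) k) * (cmod (x k))\<^sup>2" for k
            using d[of k] by (auto simp: complex_nonneg_Reals_iff)
        qed
      qed
      finally show "ell2_inner UNIV (diag_part T x) x \<in> \<real>\<^sub>\<ge>\<^sub>0"
        using d by (auto simp: complex_nonneg_Reals_iff intro!: infsum_nonneg)
    qed
    then show "(\<lambda>T\<in>bounded_opers UNIV. f (diag_part T)) T \<in> \<real>\<^sub>\<ge>\<^sub>0"
      using T by (simp add: state_positive[OF f] diag_part_in)
  qed (simp_all add: diag_part_diag[OF id_in] state_id[OF f])
  show "restrict (\<lambda>T\<in>bounded_opers UNIV. f (diag_part T)) (diagonal_opers UNIV) = f"
  proof (rule extensionalityI)
    show "f \<in> extensional (diagonal_opers UNIV)" using f by (auto simp: states_def)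
  qed (use diagonal_subset_bounded in \<open>auto simp: diag_part_diag\<close>)
qed

section \<open>Partitions of the columns of a matrix\<close>

text \<open>
  \<open>column_partition n T D R\<close> is the conclusion of the theorem for one matrix with \<open>R\<close> classes, and
  \<open>partition_property D r\<close> is its right-hand side for given constants.
\<close>

definition column_partition :: "nat \<Rightarrow> nat oper \<Rightarrow> real \<Rightarrow> nat \<Rightarrow> bool" where
  "column_partition n T D R \<longleftrightarrow> (\<exists>A :: nat \<Rightarrow> nat set.
            disjoint_family_on A {1..R} \<and>
            (\<Union>j\<in>{1..R}. A j) = {1..n} \<and>
            (\<forall>j\<in>{1..R}. \<forall>a :: nat \<Rightarrow> complex.
               (ell2_norm {1..n} (\<lambda>k. \<Sum>i\<in>A j. a i * T (ell2_basis i) k))\<^sup>2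
                 \<le> D * (\<Sum>i\<in>A j. (cmod (a i))\<^sup>2)))"

definition partition_property :: "real \<Rightarrow> (real \<Rightarrow> nat) \<Rightarrow> bool" where
  "partition_property D r \<longleftrightarrow> (\<forall>n. \<forall>T\<in>bounded_opers {1..n}.
     (\<forall>i\<in>{1..n}. ell2_norm {1..n} (T (ell2_basis i)) = 1) \<longrightarrow>
     column_partition n T D (r (oper_norm {1..n} T)))"

section \<open>From unique extension to partitions\<close>

lemma oper_norm_le:
  assumes T: "T \<in> bounded_opers I" and x: "x \<in> ell2 I"
  shows "ell2_norm I (T x) \<le> oper_norm I T * ell2_norm I x"
proof -
  obtain K where K: "0 \<le> K" "\<And>x. x \<in> ell2 I \<Longrightarrow> ell2_norm I (T x) \<le> K * ell2_norm I x"
    using oper_bounded[OF T] by blast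
  show ?thesis
  proof (cases "ell2_norm I x = 0")
    case True
    then show ?thesis using K(2)[OF x] by simp
  next
    case False
    define c where "c = inverse (ell2_norm I x)"
    have c: "0 < c" "c * ell2_norm I x = 1" using False ell2_norm_nonneg[of I x] by (simp_all add: c_def less_le)
    define y where "y = (\<lambda>i. of_real c * x i)"
    have y: "y \<in> ell2 I" "ell2_norm I y = 1"
      using c by (auto simp: y_def ell2_norm_scale ell2_scale x)
    have "ell2_norm I (T y) \<le> oper_norm I T"
      unfolding oper_norm_def
    proof (rule cSUP_upper)
      show "bdd_above ((\<lambda>x. ell2_norm I (T x)) ` {x \<in> ell2 I. ell2_norm I x \<le> 1})"
      proof (rule bdd_aboveI2)
        fix z assume "z \<in> {x \<in> ell2 I. ell2_norm I x \<le> 1}"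
        then show "ell2_norm I (T z) \<le> K" using K(2)[of z] mult_left_le[OF _ K(1), of "ell2_norm I z"] by auto
      qed
    qed (use y in auto)
    moreover have "ell2_norm I (T y) = c * ell2_norm I (T x)"
      unfolding y_def oper_scale[OF T x] using c by (simp add: ell2_norm_scale)
    ultimately show ?thesis using False ell2_norm_nonneg[of I x]
      by (simp add: c_def field_simps less_le)
  qed
qed

lemma oper_finite_sum:
  assumes T: "T \<in> bounded_opers I" and S: "finite S" "S \<subseteq> I"
  shows "(\<lambda>k. \<Sum>i\<in>S. a i * ell2_basis i k) \<in> ell2 I"
    and "T (\<lambda>k. \<Sum>i\<in>S. a i * ell2_basis i k) = (\<lambda>k. \<Sum>i\<in>S. a i * T (ell2_basis i) k)"
proof -
  have b: "ell2_basis i \<in> ell2 I" if "i \<in> I" for i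
  proof -
    have "finite {k\<in>I. (cmod (ell2_basis i k))\<^sup>2 \<noteq> 0}"
      by (rule finite_subset[of _ "{i}"]) (auto simp: ell2_basis_def)
    then show ?thesis using that
      by (auto simp: ell2_def intro!: finite_nonzero_values_imp_summable_on) (auto simp: ell2_basis_def)
  qed
  have "(\<lambda>k. \<Sum>i\<in>S. a i * ell2_basis i k) \<in> ell2 I \<and>
      T (\<lambda>k. \<Sum>i\<in>S. a i * ell2_basis i k) = (\<lambda>k. \<Sum>i\<in>S. a i * T (ell2_basis i) k)"
    using S
  proof (induction S)
    case empty
    then show ?case using oper_zero[OF T] by (simp add: ell2_def)
  next
    case (insert i S)
    then show ?case
      using ell2_lincomb[OF b[of i], of "\<lambda>k. \<Sum>i\<in>S. a i * ell2_basis i k" "a i" 1]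
        oper_linear[OF T b[of i], of "\<lambda>k. \<Sum>i\<in>S. a i * ell2_basis i k" "a i" 1] by simp
  qed
  then show "(\<lambda>k. \<Sum>i\<in>S. a i * ell2_basis i k) \<in> ell2 I"
    "T (\<lambda>k. \<Sum>i\<in>S. a i * ell2_basis i k) = (\<lambda>k. \<Sum>i\<in>S. a i * T (ell2_basis i) k)" by auto
qed

subsection \<open>Gram operators\<close>

definition gram :: "'i oper \<Rightarrow> 'i oper" where
  "gram T = (\<lambda>x\<in>ell2 UNIV. adj T (T x))"

lemma gram_in:
  assumes T: "T \<in> bounded_opers UNIV"
  shows "gram T \<in> bounded_opers UNIV"
proof -
  note A = adj_in[OF T]
  obtain K where K: "0 \<le> K" "\<And>x. x \<in> ell2 UNIV \<Longrightarrow> ell2_norm UNIV (T x) \<le> K * ell2_norm UNIV x"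
    using oper_bounded[OF T] by blast
  obtain L where L: "0 \<le> L" "\<And>x. x \<in> ell2 UNIV \<Longrightarrow> ell2_norm UNIV (adj T x) \<le> L * ell2_norm UNIV x"
    using oper_bounded[OF A] by blast
  show ?thesis unfolding gram_def
  proof (rule bounded_opersI[where K = "L * K"])
    fix x :: "'a \<Rightarrow> complex" assume x: "x \<in> ell2 UNIV"
    show "ell2_norm UNIV (adj T (T x)) \<le> L * K * ell2_norm UNIV x"
      using order_trans[OF L(2)[OF oper_in[OF T x]] mult_left_mono[OF K(2)[OF x] L(1)]]
      by (simp add: mult.assoc)
  qed (auto simp: oper_in[OF T] oper_in[OF A] oper_linear[OF T] oper_linear[OF A])
qed

lemma gram_form: "T \<in> bounded_opers UNIV \<Longrightarrow> x \<in> ell2 UNIV \<Longrightarrow>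
    ell2_inner UNIV (gram T x) x = of_real (sqn (T x))"
  by (simp add: gram_def adj_inner_left oper_in inner_self)

subsection \<open>Direct sums\<close>

text \<open>
  The direct sum of the operators \<open>T R\<close> on dimension \<open>n R\<close> acts on sequences over the naturals: coordinate \<open>i\<close> of
  block \<open>R\<close> sits at the index \<open>prod_encode (R, i)\<close>. Indices outside every block carry zero columns.
\<close>

definition block :: "(nat \<Rightarrow> nat) \<Rightarrow> nat \<Rightarrow> (nat \<Rightarrow> complex) \<Rightarrow> nat \<Rightarrow> complex" where
  "block n R x = (\<lambda>i. if i \<in> {1..n R} then x (prod_encode (R, i)) else 0)"

definition direct_sum :: "(nat \<Rightarrow> nat) \<Rightarrow> (nat \<Rightarrow> nat oper) \<Rightarrow> nat oper" where
  "direct_sum n T = (\<lambda>x\<in>ell2 UNIV. \<lambda>m. case prod_decode m of (R, j) \<Rightarrow> T R (block n R x) j)"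

lemma block_ell2: "block n R x \<in> ell2 {1..n R}"
  by (simp add: block_def ell2_def)

lemma block_norm: "(ell2_norm {1..n R} (block n R x))\<^sup>2 = (\<Sum>i\<in>{1..n R}. (cmod (x (prod_encode (R, i))))\<^sup>2)"
  by (simp add: ell2_norm_sq_finite block_def)

lemma block_sum:
  fixes f :: "nat \<Rightarrow> real"
  assumes "finite Q"
  shows "(\<Sum>m \<in> prod_encode ` (SIGMA R:Q. {1..n R}). f m) = (\<Sum>R\<in>Q. \<Sum>i\<in>{1..n R}. f (prod_encode (R, i)))"
  using assms by (subst sum.reindex) (auto simp: inj_prod_encode sum.Sigma inj_on_subset[OF inj_prod_encode] intro!: sum.cong)

lemma direct_sum_bounded_sums:
  assumes T: "\<And>R. T R \<in> bounded_opers {1..n R}"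
    and K: "\<And>Q. finite Q \<Longrightarrow> (\<Sum>R\<in>Q. (ell2_norm {1..n R} (T R (block n R x)))\<^sup>2) \<le> K"
    and x: "x \<in> ell2 UNIV"
  shows "direct_sum n T x \<in> ell2 UNIV" "sqn (direct_sum n T x) \<le> K"
proof -
  have *: "(\<Sum>m\<in>F. (cmod (direct_sum n T x m))\<^sup>2) \<le> K" if F: "finite F" for F
  proof -
    define Q where "Q = (fst \<circ> prod_decode) ` F"
    define G where "G = prod_encode ` (SIGMA R:Q. {1..n R})"
    have fin: "finite Q" "finite G" using F by (auto simp: Q_def G_def)
    have zero: "direct_sum n T x m = 0" if m: "m \<in> F - G" for m
    proof -
      obtain R j where d: "prod_decode m = (R, j)" by fastforce
      then have e: "m = prod_encode (R, j)" by (metis prod_decode_inverse)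
      have "R \<in> Q" using m d unfolding Q_def by force
      then have "j \<notin> {1..n R}" using m unfolding G_def e by blast
      then have "T R (block n R x) j = 0" using oper_in[OF T block_ell2[where n = n and R = R and x = x]] by (auto simp: ell2_def)
      then show ?thesis by (simp add: direct_sum_def x d)
    qed
    have "(\<Sum>m\<in>F. (cmod (direct_sum n T x m))\<^sup>2) \<le> (\<Sum>m\<in>F \<union> G. (cmod (direct_sum n T x m))\<^sup>2)"
      using F fin by (intro sum_mono2) auto
    also have "\<dots> = (\<Sum>m\<in>G. (cmod (direct_sum n T x m))\<^sup>2)"
      using F fin zero by (intro sum.mono_neutral_right) auto
    also have "\<dots> = (\<Sum>R\<in>Q. (ell2_norm {1..n R} (T R (block n R x)))\<^sup>2)"
      unfolding G_def block_sum[OF fin(1)] by (simp add: direct_sum_def x ell2_norm_sq_finite)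
    finally show ?thesis using K[OF fin(1)] by linarith
  qed
  show "direct_sum n T x \<in> ell2 UNIV" by (rule ell2_bounded_sums(1)[OF *])
  show "sqn (direct_sum n T x) \<le> K" by (rule ell2_bounded_sums(2)[OF *])
qed

lemma direct_sum_in:
  assumes T: "\<And>R. T R \<in> bounded_opers {1..n R}"
    and M: "\<And>R y. y \<in> ell2 {1..n R} \<Longrightarrow> ell2_norm {1..n R} (T R y) \<le> M * ell2_norm {1..n R} y" and "0 \<le> M"
  shows "direct_sum n T \<in> bounded_opers UNIV"
proof -
  have K: "(\<Sum>R\<in>Q. (ell2_norm {1..n R} (T R (block n R x)))\<^sup>2) \<le> (M * ell2_norm UNIV x)\<^sup>2"
    if x: "x \<in> ell2 UNIV" and Q: "finite Q" for x Q
  proof -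
    have "(\<Sum>R\<in>Q. (ell2_norm {1..n R} (T R (block n R x)))\<^sup>2)
      \<le> (\<Sum>R\<in>Q. M\<^sup>2 * (ell2_norm {1..n R} (block n R x))\<^sup>2)"
      unfolding power_mult_distrib[symmetric] by (intro sum_mono power_mono M block_ell2) auto
    also have "\<dots> = M\<^sup>2 * (\<Sum>m \<in> prod_encode ` (SIGMA R:Q. {1..n R}). (cmod (x m))\<^sup>2)"
      by (simp only: block_norm block_sum[OF Q] sum_distrib_left)
    also have "\<dots> \<le> M\<^sup>2 * sqn x"
      using Q by (intro mult_left_mono ell2_finite_sum_le x) auto
    finally show ?thesis by (simp add: power_mult_distrib)
  qed
  note b = direct_sum_bounded_sums[where n = n, OF T K]
  show ?thesis unfolding direct_sum_def
  proof (rule bounded_opersI)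
    fix x :: "nat \<Rightarrow> complex" assume x: "x \<in> ell2 UNIV"
    have e: "(\<lambda>m. case prod_decode m of (R, j) \<Rightarrow> T R (block n R x) j) = direct_sum n T x"
      using x by (simp add: direct_sum_def)
    show "(\<lambda>m. case prod_decode m of (R, j) \<Rightarrow> T R (block n R x) j) \<in> ell2 UNIV"
      unfolding e by (rule b(1)) (use x in auto)
    show "ell2_norm UNIV (\<lambda>m. case prod_decode m of (R, j) \<Rightarrow> T R (block n R x) j) \<le> M * ell2_norm UNIV x"
      unfolding e by (rule power2_le_imp_le, rule b(2)) (use x \<open>0 \<le> M\<close> in auto)
    fix y :: "nat \<Rightarrow> complex" and a b
    have "block n R (\<lambda>i. a * x i + b * y i) = (\<lambda>i. a * block n R x i + b * block n R y i)" for R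
      by (auto simp: block_def)
    then have "T R (block n R (\<lambda>i. a * x i + b * y i)) = (\<lambda>i. a * T R (block n R x) i + b * T R (block n R y) i)" for R
      using oper_linear[OF T block_ell2[where n = n] block_ell2[where n = n]] by simp
    then show "(\<lambda>m. case prod_decode m of (R, j) \<Rightarrow> T R (block n R (\<lambda>i. a * x i + b * y i)) j)
      = (\<lambda>i. a * (case prod_decode i of (R, j) \<Rightarrow> T R (block n R x) j)
          + b * (case prod_decode i of (R, j) \<Rightarrow> T R (block n R y) j))"
      by (intro ext) (simp split: prod.splits)
  qed
qed

lemma direct_sum_basis:
  assumes T: "\<And>R. T R \<in> bounded_opers {1..n R}"
    and unit: "\<And>R i. i \<in> {1..n R} \<Longrightarrow> ell2_norm {1..n R} (T R (ell2_basis i)) = 1"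
  shows "sqn (direct_sum n T (ell2_basis m)) \<le> 1"
proof (rule direct_sum_bounded_sums(2)[OF T _ basis_ell2])
  fix Q :: "nat set" assume Q: "finite Q"
  obtain S j where "prod_decode m = (S, j)" by fastforce
  then have m: "m = prod_encode (S, j)" by (metis prod_decode_inverse)
  have "(ell2_norm {1..n R} (T R (block n R (ell2_basis m))))\<^sup>2 \<le> (if R = S then 1 else 0)" for R
  proof (cases "R = S \<and> j \<in> {1..n R}")
    case True
    then have "block n R (ell2_basis m) = ell2_basis j"
      by (auto simp: block_def ell2_basis_def m)
    then show ?thesis using True unit[of j S] by auto
  next
    case False
    then have "block n R (ell2_basis m) = (\<lambda>i. 0)"
      by (auto simp: block_def ell2_basis_def m)
    then show ?thesis using oper_zero[OF T] by simp
  qed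
  then have "(\<Sum>R\<in>Q. (ell2_norm {1..n R} (T R (block n R (ell2_basis m))))\<^sup>2) \<le> (\<Sum>R\<in>Q. if R = S then 1 else 0)"
    by (rule sum_mono)
  also have "\<dots> \<le> 1" using Q by simp
  finally show "(\<Sum>R\<in>Q. (ell2_norm {1..n R} (T R (block n R (ell2_basis m))))\<^sup>2) \<le> 1" .
qed

lemma direct_sum_block_le:
  assumes D: "direct_sum n T \<in> bounded_opers UNIV" and T: "T R \<in> bounded_opers {1..n R}" and x: "x \<in> ell2 UNIV"
  shows "(ell2_norm {1..n R} (T R (block n R x)))\<^sup>2 \<le> sqn (direct_sum n T x)"
proof -
  have "(ell2_norm {1..n R} (T R (block n R x)))\<^sup>2
    = (\<Sum>m \<in> prod_encode ` (SIGMA R:{R}. {1..n R}). (cmod (direct_sum n T x m))\<^sup>2)"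
    by (subst block_sum) (simp_all add: direct_sum_def x ell2_norm_sq_finite)
  also have "\<dots> \<le> sqn (direct_sum n T x)"
    by (rule ell2_finite_sum_le[OF oper_in[OF D x]]) auto
  finally show ?thesis .
qed

subsection \<open>Two extensions of one pure state\<close>

definition bounded_on :: "real \<Rightarrow> 'i oper \<Rightarrow> 'i set \<Rightarrow> bool" where
  "bounded_on D T B \<longleftrightarrow> (\<forall>x\<in>ell2 UNIV. clip B x = x \<longrightarrow> sqn (T x) \<le> D * sqn x)"

text \<open>
  A finite cover by sets on which the direct sum is bounded becomes, within block \<open>R\<close>, a partition:
  assign each index to the first set that contains it.
\<close>

lemma bounded_cover_partition:
  assumes T: "T R \<in> bounded_opers {1..n R}" and D: "direct_sum n T \<in> bounded_opers UNIV"
    and cover: "\<And>m. \<exists>j\<in>{1..R}. m \<in> B j" and B: "\<And>j. j \<in> {1..R} \<Longrightarrow> bounded_on C (direct_sum n T) (B j)"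
  shows "column_partition (n R) (T R) C R"
proof -
  define first where "first i = (LEAST j. j \<in> {1..R} \<and> prod_encode (R, i) \<in> B j)" for i
  have first: "first i \<in> {1..R} \<and> prod_encode (R, i) \<in> B (first i)" for i
    unfolding first_def by (rule LeastI_ex) (use cover in blast)
  define A where "A j = {i \<in> {1..n R}. first i = j}" for j
  show ?thesis unfolding column_partition_def
  proof (intro exI[of _ A] conjI ballI allI)
    show "disjoint_family_on A {1..R}" by (auto simp: disjoint_family_on_def A_def)
    show "(\<Union>j\<in>{1..R}. A j) = {1..n R}" using first by (auto simp: A_def)
    fix j and a :: "nat \<Rightarrow> complex" assume j: "j \<in> {1..R}"
    have fin: "finite (A j)" and sub: "A j \<subseteq> {1..n R}" by (auto simp: A_def)
    define x where "x m = (case prod_decode m of (S, i) \<Rightarrow> if S = R \<and> i \<in> A j then a i else 0)" for m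
    have out: "x m = 0" if "m \<notin> (\<lambda>i. prod_encode (R, i)) ` A j" for m
    proof -
      obtain S i where "prod_decode m = (S, i)" by fastforce
      moreover from this have "m = prod_encode (S, i)" by (metis prod_decode_inverse)
      ultimately show ?thesis using that by (auto simp: x_def)
    qed
    have inj: "inj_on (\<lambda>i. prod_encode (R, i)) (A j)" by (auto simp: inj_on_def)
    have xin: "x \<in> ell2 UNIV"
      by (rule finite_support_ell2, rule finite_subset[of _ "(\<lambda>i. prod_encode (R, i)) ` A j"]) (use out fin in auto)
    have "clip (B j) x = x"
    proof
      fix m
      show "clip (B j) x m = x m"
      proof (cases "m \<in> (\<lambda>i. prod_encode (R, i)) ` A j")
        case True
        then have "m \<in> B j" using first by (auto simp: A_def)
        then show ?thesis by (simp add: clip_def)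
      qed (simp add: clip_def out)
    qed
    then have Tx: "sqn (direct_sum n T x) \<le> C * sqn x" using B[OF j] xin unfolding bounded_on_def by blast
    have sqx: "sqn x = (\<Sum>i\<in>A j. (cmod (a i))\<^sup>2)"
      by (subst finite_support_sqn[of "(\<lambda>i. prod_encode (R, i)) ` A j"])
        (use out fin in \<open>auto simp: sum.reindex[OF inj] x_def\<close>)
    have "block n R x = (\<lambda>k. \<Sum>i\<in>A j. a i * ell2_basis i k)"
    proof
      fix k
      have "(\<Sum>i\<in>A j. a i * ell2_basis i k) = (\<Sum>i\<in>A j. if k = i then a i else 0)"
        by (rule sum.cong) (auto simp: ell2_basis_def)
      also have "\<dots> = (if k \<in> A j then a k else 0)" using fin by simp
      also have "\<dots> = block n R x k" using sub by (auto simp: block_def x_def)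
      finally show "block n R x k = (\<Sum>i\<in>A j. a i * ell2_basis i k)" by simp
    qed
    then have TR: "T R (block n R x) = (\<lambda>k. \<Sum>i\<in>A j. a i * T R (ell2_basis i) k)"
      using oper_finite_sum(2)[OF T fin sub, of a] by simp
    show "(ell2_norm {1..n R} (\<lambda>k. \<Sum>i\<in>A j. a i * T R (ell2_basis i) k))\<^sup>2 \<le> C * (\<Sum>i\<in>A j. (cmod (a i))\<^sup>2)"
      using order_trans[OF direct_sum_block_le[OF D T xin] Tx] unfolding TR sqx .
  qed
qed

text \<open>
  The sets on which \<open>T\<close> is bounded generate a proper ideal, so an ultrafilter \<open>U\<close> avoids them. Each member
  of \<open>U\<close> then supports a unit vector \<open>x\<close> with \<open>\<parallel>T x\<parallel>\<^sup>2 \<ge> 2\<close>, and an ultrafilter \<open>W\<close> on such vectors, with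
  supports shrinking along \<open>U\<close>, yields a second extension that the operator \<open>T\<^sup>* T\<close> separates from the limit along the basis vectors.
\<close>

lemma no_bounded_cover_imp_not_KS:
  fixes T :: "nat oper"
  assumes T: "T \<in> bounded_opers UNIV" and unit: "\<And>m. sqn (T (ell2_basis m)) \<le> 1"
    and nocover: "\<And>X. finite X \<Longrightarrow> (\<And>B. B \<in> X \<Longrightarrow> bounded_on 2 T B) \<Longrightarrow> \<Union> X \<noteq> UNIV"
  shows "\<not> Kadison_Singer"
proof
  assume KS: Kadison_Singer
  \<comment> \<open>generated by the complements of the sets on which \<open>T\<close> is bounded\<close>
  let ?F = "INF B\<in>{B. bounded_on 2 T B}. principal (- B)"
  have "?F \<noteq> bot"
  proof (rule INF_filter_not_bot)
    fix X assume X: "X \<subseteq> {B. bounded_on 2 T B}" "finite X"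
    have "(INF B\<in>X. principal (- B)) = principal (\<Inter>B\<in>X. - B)" by (rule INF_principal_finite[OF X(2)])
    moreover have "(\<Inter>B\<in>X. - B) \<noteq> {}" using nocover[of X] X by auto
    ultimately show "(INF B\<in>X. principal (- B)) \<noteq> bot" by (simp add: principal_eq_bot_iff)
  qed
  then obtain U where U: "U \<le> ?F" "ultrafilter U" using ultrafilter_exists by blast
  have large: "\<not> bounded_on 2 T B" if B: "eventually (\<lambda>i. i \<in> B) U" for B
  proof
    assume "bounded_on 2 T B"
    then have "eventually (\<lambda>i. i \<in> - B) ?F" by (intro eventually_INF1[of B]) (auto simp: eventually_principal)
    then have "eventually (\<lambda>i. i \<in> - B) U" using U(1) filter_leD by blast
    with B have "eventually (\<lambda>i. False) U" by eventually_elim auto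
    then show False using ultrafilterD(1)[OF U(2)] by (simp add: trivial_limit_def)
  qed
  define V where "V B = {x \<in> ell2 UNIV. clip B x = x \<and> ell2_norm UNIV x = 1 \<and> 2 \<le> sqn (T x)}" for B
  have Vne: "V B \<noteq> {}" if B: "eventually (\<lambda>i. i \<in> B) U" for B
  proof -
    obtain x where x: "x \<in> ell2 UNIV" "clip B x = x" "2 * sqn x < sqn (T x)"
      using large[OF B] by (auto simp: bounded_on_def not_le)
    have "ell2_norm UNIV x \<noteq> 0"
    proof
      assume "ell2_norm UNIV x = 0"
      then have "x = (\<lambda>i. 0)" by (rule ell2_norm_eq_0[OF x(1)])
      then show False using x(3) oper_zero[OF T] by simp
    qed
    define c where "c = 1 / ell2_norm UNIV x"
    have c: "0 < c" "c * ell2_norm UNIV x = 1"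
      using \<open>ell2_norm UNIV x \<noteq> 0\<close> by (auto simp: c_def less_le)
    have "(\<lambda>i. of_real c * x i) \<in> V B"
      unfolding V_def mem_Collect_eq
    proof (intro conjI)
      show "(\<lambda>i. of_real c * x i) \<in> ell2 UNIV" by (rule ell2_scale[OF x(1)])
      show "clip B (\<lambda>i. of_real c * x i) = (\<lambda>i. of_real c * x i)"
        by (subst (2) x(2)[symmetric]) (auto simp: clip_def)
      show "ell2_norm UNIV (\<lambda>i. of_real c * x i) = 1" using c by (simp add: ell2_norm_scale)
      have "2 = 2 * (c * ell2_norm UNIV x)\<^sup>2" using c by simp
      also have "\<dots> = c\<^sup>2 * (2 * sqn x)" by (simp add: power_mult_distrib)
      also have "\<dots> \<le> c\<^sup>2 * sqn (T x)" using x(3) by (intro mult_left_mono) auto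
      also have "\<dots> = sqn (T (\<lambda>i. of_real c * x i))"
        by (simp add: oper_scale[OF T x(1)] ell2_norm_scale power_mult_distrib)
      finally show "2 \<le> sqn (T (\<lambda>i. of_real c * x i))" .
    qed
    then show ?thesis by blast
  qed
  let ?G = "INF B\<in>{B. eventually (\<lambda>i. i \<in> B) U}. principal (V B)"
  have "?G \<noteq> bot"
  proof (rule INF_filter_not_bot)
    fix X assume X: "X \<subseteq> {B. eventually (\<lambda>i. i \<in> B) U}" "finite X"
    have "eventually (\<lambda>i. i \<in> \<Inter>X) U" using X by (auto simp: eventually_ball_finite_distrib Inter_iff)
    then obtain x where x: "x \<in> V (\<Inter>X)" using Vne by blast
    have "x \<in> V B" if "B \<in> X" for B
      using x that unfolding V_def by (auto simp: clip_def fun_eq_iff) metis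
    then have "x \<in> (\<Inter>B\<in>X. V B)" by blast
    moreover have "(INF B\<in>X. principal (V B)) = principal (\<Inter>B\<in>X. V B)" by (rule INF_principal_finite[OF X(2)])
    ultimately show "(INF B\<in>X. principal (V B)) \<noteq> bot" by (auto simp: principal_eq_bot_iff)
  qed
  then obtain W where W: "W \<le> ?G" "ultrafilter W" using ultrafilter_exists by blast
  have inV: "eventually (\<lambda>x. x \<in> V B) W" if "eventually (\<lambda>i. i \<in> B) U" for B
    by (rule filter_leD[OF W(1)], rule eventually_INF1[of B]) (use that in \<open>auto simp: eventually_principal\<close>)
  have Wunit: "eventually (\<lambda>x. x \<in> ell2 UNIV \<and> ell2_norm UNIV x = 1) W"
    using inV[of UNIV, simplified] by eventually_elim (auto simp: V_def)
  let ?B = "bounded_opers UNIV :: nat oper set" and ?D = "diagonal_opers UNIV :: nat oper set"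
  define E where "E = filtermap ell2_basis U"
  note basis = basis_vectors_ultrafilter[OF U(2), folded E_def]
  define f g h where "f = vector_state E ?D" and "g = vector_state E ?B" and "h = vector_state W ?B"
  have f: "f \<in> pure_states UNIV ?D" "f \<in> states UNIV ?D"
    unfolding f_def E_def using ultralimit_state_pure[OF U(2)] by (auto simp: pure_states_def)
  have g: "g \<in> states UNIV ?B" unfolding g_def by (rule vector_state_state[OF basis oper_space_bounded])
  have h: "h \<in> states UNIV ?B" unfolding h_def by (rule vector_state_state[OF W(2) Wunit oper_space_bounded])
  have "restrict g ?D = f"
    unfolding g_def f_def vector_state_def using diagonal_subset_bounded[of UNIV] by (auto simp: fun_eq_iff restrict_def)
  moreover have "restrict h ?D = f"
  proof (rule extensionalityI)
    show "f \<in> extensional ?D" using f(2) by (auto simp: states_def)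
    fix S assume S: "S \<in> ?D"
    have "h (proj B) = 1" if B: "eventually (\<lambda>i. i \<in> B) U" for B
      unfolding h_def
    proof (rule vector_state_eqI[OF W(2) Wunit oper_space_bounded])
      show "proj B \<in> ?B" using proj_in diagonal_subset_bounded by blast
    next
      show "((\<lambda>x. ell2_inner UNIV (proj B x) x) \<longlongrightarrow> 1) W"
      proof (rule tendsto_eventually)
        show "eventually (\<lambda>x. ell2_inner UNIV (proj B x) x = 1) W"
          using inV[OF B] by eventually_elim (auto simp: V_def inner_proj)
      qed
    qed
    then have "((\<lambda>k. S (ell2_basis k) k) \<longlongrightarrow> h S) U"
      by (intro state_eq_ultralimit[OF U(2) oper_space_bounded h _ S])
    moreover have "((\<lambda>k. S (ell2_basis k) k) \<longlongrightarrow> f S) U"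
      by (rule state_eq_ultralimit[OF U(2) oper_space_diagonal f(2) _ S])
        (use basis_state_proj[OF U(2) oper_space_diagonal] in \<open>auto simp: f_def E_def\<close>)
    ultimately show "restrict h ?D S = f S" using S tendsto_unique[OF ultrafilterD(1)[OF U(2)]] by auto
  qed simp
  ultimately have gh: "g = h" using KS f(1) g h unfolding Kadison_Singer_def by blast
  note G = gram_in[OF T]
  have "((\<lambda>x. Re (ell2_inner UNIV (gram T x) x)) \<longlongrightarrow> Re (g (gram T))) E"
    unfolding g_def by (intro tendsto_intros vector_state_tendsto[OF basis oper_space_bounded G])
  moreover have "eventually (\<lambda>x. Re (ell2_inner UNIV (gram T x) x) \<le> 1) E"
    unfolding E_def eventually_filtermap by (simp add: gram_form[OF T basis_ell2] unit)
  ultimately have "Re (g (gram T)) \<le> 1"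
    using ultrafilterD(1)[OF basis(1)] by (intro tendsto_upperbound)
  moreover have "((\<lambda>x. Re (ell2_inner UNIV (gram T x) x)) \<longlongrightarrow> Re (h (gram T))) W"
    unfolding h_def by (intro tendsto_intros vector_state_tendsto[OF W(2) Wunit oper_space_bounded G])
  moreover have "eventually (\<lambda>x. 2 \<le> Re (ell2_inner UNIV (gram T x) x)) W"
    using inV[of UNIV, simplified] by eventually_elim (auto simp: V_def gram_form[OF T])
  ultimately have "Re (g (gram T)) \<le> 1" "2 \<le> Re (h (gram T))"
    using ultrafilterD(1)[OF W(2)] by (auto intro: tendsto_lowerbound)
  then show False using gh by simp
qed

text \<open>
  For the norm \<open>M\<close>, the direct sum of matrices \<open>T R\<close> that cannot be split into \<open>R\<close> classes admits no finite cover by bounded sets: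
  a cover by \<open>R\<close> sets would split \<open>T R\<close>.
\<close>

lemma KS_imp_partition:
  assumes KS: Kadison_Singer
  shows "\<exists>R. \<forall>n. \<forall>T\<in>bounded_opers {1..n}.
    (\<forall>i\<in>{1..n}. ell2_norm {1..n} (T (ell2_basis i)) = 1) \<longrightarrow> oper_norm {1..n} T = M \<longrightarrow> column_partition n T 2 R"
proof (rule ccontr)
  assume "\<not> ?thesis"
  then have "\<forall>R. \<exists>n. \<exists>T. T \<in> bounded_opers {1..n} \<and> (\<forall>i\<in>{1..n}. ell2_norm {1..n} (T (ell2_basis i)) = 1) \<and>
      oper_norm {1..n} T = M \<and> \<not> column_partition n T 2 R"
    by blast
  from choice[OF this] obtain n where "\<forall>R. \<exists>T. T \<in> bounded_opers {1..n R} \<and>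
      (\<forall>i\<in>{1..n R}. ell2_norm {1..n R} (T (ell2_basis i)) = 1) \<and>
      oper_norm {1..n R} T = M \<and> \<not> column_partition (n R) T 2 R" ..
  from choice[OF this] obtain T where T: "\<And>R. T R \<in> bounded_opers {1..n R}"
    and unit: "\<And>R i. i \<in> {1..n R} \<Longrightarrow> ell2_norm {1..n R} (T R (ell2_basis i)) = 1"
    and norm: "\<And>R. oper_norm {1..n R} (T R) = M" and bad: "\<And>R. \<not> column_partition (n R) (T R) 2 R"
    by blast
  have le: "ell2_norm {1..n R} (T R y) \<le> \<bar>M\<bar> * ell2_norm {1..n R} y" if "y \<in> ell2 {1..n R}" for R y
    using oper_norm_le[OF T that] mult_right_mono[OF abs_ge_self[of M] ell2_norm_nonneg[of "{1..n R}" y]]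
    unfolding norm by linarith
  have D: "direct_sum n T \<in> bounded_opers UNIV" by (rule direct_sum_in[OF T le]) auto
  have "\<not> Kadison_Singer"
  proof (rule no_bounded_cover_imp_not_KS[OF D])
    show "sqn (direct_sum n T (ell2_basis m)) \<le> 1" for m by (rule direct_sum_basis[OF T unit])
    fix X :: "nat set set" assume X: "finite X" "\<And>B. B \<in> X \<Longrightarrow> bounded_on 2 (direct_sum n T) B"
    show "\<Union> X \<noteq> UNIV"
    proof
      assume cover: "\<Union> X = UNIV"
      obtain B where B: "bij_betw B {1..card X} X" using ex_bij_betw_nat_finite_1[OF X(1)] by blast
      have "column_partition (n (card X)) (T (card X)) 2 (card X)"
      proof (rule bounded_cover_partition[OF T D])
        show "\<exists>j\<in>{1..card X}. m \<in> B j" for m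
        proof -
          have "B ` {1..card X} = X" using B by (simp add: bij_betw_def)
          moreover have "m \<in> \<Union> X" by (simp add: cover)
          then obtain A where "A \<in> X" "m \<in> A" by (rule UnionE)
          ultimately show ?thesis by (metis imageE)
        qed
        show "bounded_on 2 (direct_sum n T) (B j)" if "j \<in> {1..card X}" for j
          by (rule X(2)) (use bij_betwE[OF B] that in blast)
      qed
      then show False using bad by blast
    qed
  qed
  then show False using KS by blast
qed

section \<open>From partitions to unique extension\<close>

definition matrix_oper :: "nat \<Rightarrow> (nat \<Rightarrow> nat \<Rightarrow> complex) \<Rightarrow> nat oper" where
  "matrix_oper n m = (\<lambda>x\<in>ell2 {1..n}. \<lambda>j. if j \<in> {1..n} then \<Sum>i\<in>{1..n}. m j i * x i else 0)"

lemma ell2_finite: "finite I \<Longrightarrow> x \<in> ell2 I \<longleftrightarrow> (\<forall>i. i \<notin> I \<longrightarrow> x i = 0)"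
  by (simp add: ell2_def)

lemma matrix_oper_bounded:
  assumes bd: "\<And>x. (\<Sum>j\<in>{1..n}. (cmod (\<Sum>i\<in>{1..n}. m j i * x i))\<^sup>2) \<le> M\<^sup>2 * (\<Sum>i\<in>{1..n}. (cmod (x i))\<^sup>2)"
    and M: "0 \<le> M"
  shows "matrix_oper n m \<in> bounded_opers {1..n}"
    and "\<And>x. x \<in> ell2 {1..n} \<Longrightarrow> ell2_norm {1..n} (matrix_oper n m x) \<le> M * ell2_norm {1..n} x"
proof -
  have *: "ell2_norm {1..n} (\<lambda>j. if j \<in> {1..n} then \<Sum>i\<in>{1..n}. m j i * x i else 0) \<le> M * ell2_norm {1..n} x" for x
    by (rule power2_le_imp_le) (use bd[of x] M in \<open>simp_all add: ell2_norm_sq_finite power_mult_distrib\<close>)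
  then show "\<And>x. x \<in> ell2 {1..n} \<Longrightarrow> ell2_norm {1..n} (matrix_oper n m x) \<le> M * ell2_norm {1..n} x"
    by (simp add: matrix_oper_def)
  show "matrix_oper n m \<in> bounded_opers {1..n}" unfolding matrix_oper_def
    by (rule bounded_opersI[OF _ _ *])
      (auto simp: ell2_finite sum_distrib_left sum.distrib algebra_simps fun_eq_iff)
qed

lemma basis_ell2_finite: "(i::nat) \<in> {1..n} \<Longrightarrow> ell2_basis i \<in> ell2 {1..n}"
  unfolding ell2_finite[OF finite_atLeastAtMost] by (auto simp: ell2_basis_def)

lemma matrix_oper_basis:
  assumes "i \<in> {1..n}"
  shows "matrix_oper n m (ell2_basis i) j = (if j \<in> {1..n} then m j i else 0)"
proof -
  have "(\<Sum>k\<in>{1..n}. m j k * ell2_basis i k) = (\<Sum>k\<in>{1..n}. if k = i then m j i else 0)"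
    by (rule sum.cong) (auto simp: ell2_basis_def)
  then show ?thesis using assms basis_ell2_finite[OF assms] by (simp add: matrix_oper_def)
qed

lemma oper_norm_eqI:
  assumes "\<And>x. x \<in> ell2 I \<Longrightarrow> ell2_norm I (T x) \<le> M * ell2_norm I x" "0 \<le> M"
    and "x0 \<in> ell2 I" "ell2_norm I x0 = 1" "ell2_norm I (T x0) = M"
  shows "oper_norm I T = M"
  unfolding oper_norm_def
proof (rule cSup_eq_maximum)
  show "M \<in> (\<lambda>x. ell2_norm I (T x)) ` {x \<in> ell2 I. ell2_norm I x \<le> 1}" using assms by force
  fix y assume "y \<in> (\<lambda>x. ell2_norm I (T x)) ` {x \<in> ell2 I. ell2_norm I x \<le> 1}"
  then obtain x where x: "x \<in> ell2 I" "ell2_norm I x \<le> 1" "y = ell2_norm I (T x)" by auto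
  then have "y \<le> M * ell2_norm I x" using assms(1) by simp
  also have "\<dots> \<le> M * 1" using x assms(2) by (intro mult_left_mono)
  finally show "y \<le> M" by simp
qed

lemma sum_three_blocks:
  fixes f :: "nat \<Rightarrow> 'a::comm_monoid_add"
  shows "(\<Sum>i\<in>{1..2*n+k}. f i) = (\<Sum>i\<in>{1..n}. f i) + (\<Sum>i\<in>{1..n}. f (n + i)) + (\<Sum>i\<in>{1..k}. f (2*n + i))"
proof -
  have "{1..2*n+k} = {1..n} \<union> ((+) n ` {1..n} \<union> (+) (2*n) ` {1..k})"
  proof (intro equalityI subsetI)
    fix i assume i: "i \<in> {1..2*n+k}"
    consider "i \<le> n" | "n < i" "i \<le> 2*n" | "2*n < i" by linarith
    then show "i \<in> {1..n} \<union> ((+) n ` {1..n} \<union> (+) (2*n) ` {1..k})"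
    proof cases
      case 2
      then have "i = n + (i - n)" "i - n \<in> {1..n}" by auto
      then show ?thesis by blast
    next
      case 3
      then have "i = 2*n + (i - 2*n)" "i - 2*n \<in> {1..k}" using i by auto
      then show ?thesis by blast
    qed (use i in auto)
  qed auto
  moreover have "sum f ({1..n} \<union> ((+) n ` {1..n} \<union> (+) (2*n) ` {1..k}))
      = sum f {1..n} + (sum f ((+) n ` {1..n}) + sum f ((+) (2*n) ` {1..k}))"
    by (subst sum.union_disjoint; (subst sum.union_disjoint)?) auto
  moreover have "sum f ((+) n ` {1..n}) = (\<Sum>i\<in>{1..n}. f (n + i))"
    "sum f ((+) (2*n) ` {1..k}) = (\<Sum>i\<in>{1..k}. f (2*n + i))"
    by (subst sum.reindex; simp add: o_def)+
  ultimately show ?thesis by (simp only: add.assoc)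
qed

text \<open>
  The partition property speaks of unit columns and of a number of classes that is tied to the exact norm,
  with no monotonicity. So a matrix \<open>s\<close> of size \<open>n\<close> with columns of norm at most 1 is enlarged to size \<open>2 n + k\<close>. Rows
  \<open>n + 1, \<dots>, 2 n\<close> complete its columns to unit vectors; columns \<open>n + 1, \<dots>, 2 n\<close> are basis vectors; the last
  \<open>k\<close> columns all equal the basis vector \<open>2 n + 1\<close>, a block of norm \<open>sqrt k\<close>, which dominates when \<open>k\<close> is
  large. The norm is then \<open>sqrt k\<close> for all \<open>n\<close> and all \<open>s\<close> of squared norm at most \<open>k - 2\<close>.
\<close>

definition padded :: "nat \<Rightarrow> nat \<Rightarrow> (nat \<Rightarrow> nat \<Rightarrow> complex) \<Rightarrow> nat \<Rightarrow> nat \<Rightarrow> complex" where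
  "padded n k s j i =
    (if i \<le> n then (if j \<le> n then s j i
                   else if j = n + i then of_real (sqrt (1 - (\<Sum>l\<in>{1..n}. (cmod (s l i))\<^sup>2))) else 0)
     else if i \<le> 2 * n then (if j = i then 1 else 0)
     else (if j = 2 * n + 1 then 1 else 0))"

lemma sum_delta_shift: "l \<in> {1..n} \<Longrightarrow> (\<Sum>i\<in>{1..n::nat}. (if l = i then f i else 0) * x i) = f l * (x l :: complex)"
  by (subst sum.cong[OF refl, of _ _ "\<lambda>i. if l = i then f i * x i else 0"]) auto

lemma padded_row:
  shows "j \<in> {1..n} \<Longrightarrow> (\<Sum>i\<in>{1..2*n+k}. padded n k s j i * x i) = (\<Sum>i\<in>{1..n}. s j i * x i)"
    and "l \<in> {1..n} \<Longrightarrow> (\<Sum>i\<in>{1..2*n+k}. padded n k s (n + l) i * x i)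
      = of_real (sqrt (1 - (\<Sum>j\<in>{1..n}. (cmod (s j l))\<^sup>2))) * x l + x (n + l)"
    and "l \<in> {1..k} \<Longrightarrow> (\<Sum>i\<in>{1..2*n+k}. padded n k s (2 * n + l) i * x i)
      = (if l = 1 then \<Sum>i\<in>{1..k}. x (2 * n + i) else 0)"
proof -
  show "(\<Sum>i\<in>{1..2*n+k}. padded n k s j i * x i) = (\<Sum>i\<in>{1..n}. s j i * x i)" if "j \<in> {1..n}"
    using that unfolding sum_three_blocks by (simp add: padded_def)
  show "(\<Sum>i\<in>{1..2*n+k}. padded n k s (n + l) i * x i)
      = of_real (sqrt (1 - (\<Sum>j\<in>{1..n}. (cmod (s j l))\<^sup>2))) * x l + x (n + l)" if l: "l \<in> {1..n}"
  proof -
    have "(\<Sum>i\<in>{1..n}. padded n k s (n + l) i * x i) =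
      (\<Sum>i\<in>{1..n}. (if l = i then of_real (sqrt (1 - (\<Sum>j\<in>{1..n}. (cmod (s j i))\<^sup>2))) else 0) * x i)"
      using l by (intro sum.cong) (auto simp: padded_def)
    moreover have "(\<Sum>i\<in>{1..n}. padded n k s (n + l) (n + i) * x (n + i))
      = (\<Sum>i\<in>{1..n}. (if l = i then (\<lambda>_. 1) i else 0) * (\<lambda>i. x (n + i)) i)"
      using l by (intro sum.cong) (auto simp: padded_def)
    moreover have "(\<Sum>i\<in>{1..k}. padded n k s (n + l) (2 * n + i) * x (2 * n + i)) = 0"
      using l by (intro sum.neutral) (auto simp: padded_def)
    ultimately show ?thesis unfolding sum_three_blocks sum_delta_shift[OF l] by simp
  qed
  show "(\<Sum>i\<in>{1..2*n+k}. padded n k s (2 * n + l) i * x i)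
      = (if l = 1 then \<Sum>i\<in>{1..k}. x (2 * n + i) else 0)" if l: "l \<in> {1..k}"
  proof -
    have "(\<Sum>i\<in>{1..n}. padded n k s (2 * n + l) i * x i) = 0"
      "(\<Sum>i\<in>{1..n}. padded n k s (2 * n + l) (n + i) * x (n + i)) = 0"
      "(\<Sum>i\<in>{1..k}. padded n k s (2 * n + l) (2 * n + i) * x (2 * n + i)) = (if l = 1 then \<Sum>i\<in>{1..k}. x (2 * n + i) else 0)"
      using l by (auto simp: padded_def intro!: sum.neutral sum.cong)
    then show ?thesis unfolding sum_three_blocks by simp
  qed
qed

text \<open>
  The three row blocks are estimated separately. The second costs \<open>2 (\<parallel>a\<parallel>\<^sup>2 + \<parallel>b\<parallel>\<^sup>2)\<close> for the first two blocks \<open>a, b\<close>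
  of \<open>x\<close>, which is where \<open>M + 2 \<le> k\<close> enters.
\<close>

lemma padded_bound:
  assumes bd: "(\<Sum>j\<in>{1..n}. (cmod (\<Sum>i\<in>{1..n}. s j i * x i))\<^sup>2) \<le> M * (\<Sum>i\<in>{1..n}. (cmod (x i))\<^sup>2)"
    and col: "\<And>i. i \<in> {1..n} \<Longrightarrow> (\<Sum>j\<in>{1..n}. (cmod (s j i))\<^sup>2) \<le> 1"
    and k: "M + 2 \<le> real k" "0 \<le> M"
  shows "(\<Sum>j\<in>{1..2*n+k}. (cmod (\<Sum>i\<in>{1..2*n+k}. padded n k s j i * x i))\<^sup>2)
    \<le> real k * (\<Sum>i\<in>{1..2*n+k}. (cmod (x i))\<^sup>2)"
proof -
  let ?P = "\<lambda>j. (cmod (\<Sum>i\<in>{1..2*n+k}. padded n k s j i * x i))\<^sup>2"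
  let ?a = "\<Sum>i\<in>{1..n}. (cmod (x i))\<^sup>2" and ?b = "\<Sum>i\<in>{1..n}. (cmod (x (n + i)))\<^sup>2"
    and ?c = "\<Sum>i\<in>{1..k}. (cmod (x (2 * n + i)))\<^sup>2"
  have "(\<Sum>j\<in>{1..n}. ?P j) \<le> M * ?a" using bd by (simp add: padded_row(1) del: One_nat_def)
  moreover have "(\<Sum>l\<in>{1..n}. ?P (n + l)) \<le> 2 * ?a + 2 * ?b"
  proof -
    have "?P (n + l) \<le> 2 * (cmod (x l))\<^sup>2 + 2 * (cmod (x (n + l)))\<^sup>2" if l: "l \<in> {1..n}" for l
    proof -
      define q where "q = sqrt (1 - (\<Sum>j\<in>{1..n}. (cmod (s j l))\<^sup>2))"
      have q: "0 \<le> q" "q \<le> 1" using col[OF l] by (auto simp: q_def sum_nonneg)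
      then have "(cmod (of_real q * x l))\<^sup>2 \<le> (cmod (x l))\<^sup>2"
        by (intro power_mono) (auto simp: norm_mult mult_left_le_one_le)
      then show ?thesis unfolding padded_row(2)[OF l] q_def[symmetric]
        using cmod_add_sq_le[of "of_real q * x l" "x (n + l)"] by linarith
    qed
    then have "(\<Sum>l\<in>{1..n}. ?P (n + l)) \<le> (\<Sum>l\<in>{1..n}. 2 * (cmod (x l))\<^sup>2 + 2 * (cmod (x (n + l)))\<^sup>2)"
      by (rule sum_mono)
    then show ?thesis by (simp add: sum.distrib sum_distrib_left)
  qed
  moreover have "(\<Sum>l\<in>{1..k}. ?P (2 * n + l)) \<le> real k * ?c"
  proof -
    have "(\<Sum>l\<in>{1..k}. ?P (2 * n + l)) = (\<Sum>l\<in>{1..k}. if l = 1 then (cmod (\<Sum>i\<in>{1..k}. x (2 * n + i)))\<^sup>2 else 0)"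
      by (rule sum.cong) (auto simp: padded_row(3) simp del: One_nat_def)
    also have "\<dots> \<le> (cmod (\<Sum>i\<in>{1..k}. x (2 * n + i)))\<^sup>2" by simp
    also have "\<dots> \<le> (\<Sum>i\<in>{1..k}. cmod (x (2 * n + i)))\<^sup>2" by (intro power_mono norm_sum) auto
    also have "\<dots> \<le> real k * ?c"
      using Cauchy_Schwarz_ineq_sum[of "\<lambda>_. 1" "\<lambda>i. cmod (x (2 * n + i))" "{1..k}"] by simp
    finally show ?thesis .
  qed
  moreover have "(M + 2) * ?a \<le> real k * ?a" "2 * ?b \<le> real k * ?b"
    using k by (intro mult_right_mono sum_nonneg; simp)+
  ultimately show ?thesis unfolding sum_three_blocks[of "?P"] sum_three_blocks[of "\<lambda>i. (cmod (x i))\<^sup>2"]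
    by (simp add: algebra_simps)
qed

lemma padded_column:
  assumes col: "\<And>i. i \<in> {1..n} \<Longrightarrow> (\<Sum>j\<in>{1..n}. (cmod (s j i))\<^sup>2) \<le> 1" and i: "i \<in> {1..2*n+k}"
  shows "(\<Sum>j\<in>{1..2*n+k}. (cmod (padded n k s j i))\<^sup>2) = 1"
proof -
  consider "i \<in> {1..n}" | "i \<in> {n+1..2*n}" | "i \<in> {2*n+1..2*n+k}" using i by (auto simp: not_le) linarith
  then show ?thesis
  proof cases
    case 1
    have "(\<Sum>l\<in>{1..n}. (cmod (padded n k s (n + l) i))\<^sup>2)
      = (\<Sum>l\<in>{1..n}. if l = i then 1 - (\<Sum>j\<in>{1..n}. (cmod (s j i))\<^sup>2) else 0)"
      using 1 col[OF 1] by (intro sum.cong) (auto simp: padded_def)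
    then have "(\<Sum>l\<in>{1..n}. (cmod (padded n k s (n + l) i))\<^sup>2) = 1 - (\<Sum>j\<in>{1..n}. (cmod (s j i))\<^sup>2)"
      using 1 by simp
    moreover have "(\<Sum>l\<in>{1..k}. (cmod (padded n k s (2 * n + l) i))\<^sup>2) = 0"
      using 1 by (intro sum.neutral) (auto simp: padded_def)
    moreover have "(\<Sum>l\<in>{1..n}. (cmod (padded n k s l i))\<^sup>2) = (\<Sum>l\<in>{1..n}. (cmod (s l i))\<^sup>2)"
      using 1 by (intro sum.cong) (auto simp: padded_def)
    ultimately show ?thesis unfolding sum_three_blocks by simp
  next
    case 2
    have "(\<Sum>j\<in>{1..2*n+k}. (cmod (padded n k s j i))\<^sup>2) = (\<Sum>j\<in>{1..2*n+k}. if j = i then 1 else 0)"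
      using 2 by (intro sum.cong) (auto simp: padded_def)
    then show ?thesis using i by simp
  next
    case 3
    have "(\<Sum>j\<in>{1..2*n+k}. (cmod (padded n k s j i))\<^sup>2) = (\<Sum>j\<in>{1..2*n+k}. if j = 2*n+1 then 1 else 0)"
      using 3 by (intro sum.cong) (auto simp: padded_def)
    then show ?thesis using 3 by simp
  qed
qed

text \<open>
  The partition property freed from its normalisations: columns of norm at most 1, any bound \<open>M\<close> on the
  squared norm, and a number of classes \<open>R\<close> that depends on \<open>M\<close> only, namely \<open>r (sqrt k)\<close> for the norm \<open>sqrt k\<close> of the
  padded matrices.
\<close>

lemma partition_columns:
  assumes P: "partition_property D r" and M: "0 \<le> M"
  shows "\<exists>R::nat. \<forall>n s. (\<forall>x. (\<Sum>j\<in>{1..n}. (cmod (\<Sum>i\<in>{1..n}. s j i * x i))\<^sup>2) \<le> M * (\<Sum>i\<in>{1..n}. (cmod (x i))\<^sup>2)) \<longrightarrow>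
      (\<forall>i\<in>{1..n}. (\<Sum>j\<in>{1..n}. (cmod (s j i))\<^sup>2) \<le> 1) \<longrightarrow>
      (\<exists>c::nat \<Rightarrow> nat. (\<forall>i\<in>{1..n}. c i \<in> {1..R}) \<and>
        (\<forall>l x. (\<forall>i. x i \<noteq> 0 \<longrightarrow> c i = l) \<longrightarrow>
          (\<Sum>j\<in>{1..n}. (cmod (\<Sum>i\<in>{1..n}. s j i * x i))\<^sup>2) \<le> D * (\<Sum>i\<in>{1..n}. (cmod (x i))\<^sup>2)))"
proof -
  define k where "k = nat \<lceil>M + 2\<rceil>"
  have k: "M + 2 \<le> real k" using M unfolding k_def by linarith
  then have k1: "1 \<le> k" using M by (cases k) auto
  show ?thesis
  proof (intro exI[of _ "r (sqrt k)"] allI impI)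
    fix n and s :: "nat \<Rightarrow> nat \<Rightarrow> complex"
    let ?R = "r (sqrt k)"
    assume bd: "\<forall>x. (\<Sum>j\<in>{1..n}. (cmod (\<Sum>i\<in>{1..n}. s j i * x i))\<^sup>2) \<le> M * (\<Sum>i\<in>{1..n}. (cmod (x i))\<^sup>2)"
      and col: "\<forall>i\<in>{1..n}. (\<Sum>j\<in>{1..n}. (cmod (s j i))\<^sup>2) \<le> 1"
    define N m T where "N = 2 * n + k" and "m = padded n k s" and "T = matrix_oper N m"
    have mb: "(\<Sum>j\<in>{1..N}. (cmod (\<Sum>i\<in>{1..N}. m j i * x i))\<^sup>2) \<le> (sqrt k)\<^sup>2 * (\<Sum>i\<in>{1..N}. (cmod (x i))\<^sup>2)" for x
      using padded_bound[where s = s and n = n and x = x and M = M and k = k] bd col k M by (simp add: N_def m_def)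
    note T = matrix_oper_bounded[OF mb real_sqrt_ge_zero[OF of_nat_0_le_iff], folded T_def]
    have norm: "oper_norm {1..N} T = sqrt k"
    proof (rule oper_norm_eqI)
      \<comment> \<open>the last \<open>k\<close> equal columns attain the norm at their normalised sum\<close>
      define x0 where "x0 i = (if i \<in> {2*n+1..2*n+k} then complex_of_real (1 / sqrt k) else 0)" for i
      show "x0 \<in> ell2 {1..N}" by (auto simp: ell2_finite x0_def N_def)
      have "(ell2_norm {1..N} x0)\<^sup>2 = (\<Sum>i\<in>{1..k}. 1 / real k)"
        unfolding ell2_norm_sq_finite[OF finite_atLeastAtMost] N_def sum_three_blocks
        by (simp add: x0_def norm_divide power_divide)
      then have "(ell2_norm {1..N} x0)\<^sup>2 = 1" using k1 by simp
      then show "ell2_norm {1..N} x0 = 1" by (metis abs_of_nonneg abs_square_eq_1 ell2_norm_nonneg)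
      have "(ell2_norm {1..N} (T x0))\<^sup>2 = (\<Sum>j\<in>{1..N}. (cmod (\<Sum>i\<in>{1..N}. m j i * x0 i))\<^sup>2)"
        unfolding ell2_norm_sq_finite[OF finite_atLeastAtMost] T_def matrix_oper_def
        using \<open>x0 \<in> ell2 {1..N}\<close> by simp
      also have "\<dots> = real k"
      proof -
        have "(\<Sum>j\<in>{1..n}. (cmod (\<Sum>i\<in>{1..N}. m j i * x0 i))\<^sup>2) = 0"
          "(\<Sum>l\<in>{1..n}. (cmod (\<Sum>i\<in>{1..N}. m (n + l) i * x0 i))\<^sup>2) = 0"
          unfolding N_def m_def by (intro sum.neutral ballI; simp add: padded_row(1,2) x0_def del: One_nat_def)+
        moreover have "(\<Sum>l\<in>{1..k}. (cmod (\<Sum>i\<in>{1..N}. m (2 * n + l) i * x0 i))\<^sup>2)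
          = (\<Sum>l\<in>{1..k}. if l = 1 then real k else 0)"
        proof (rule sum.cong[OF refl])
          fix l assume l: "l \<in> {1..k}"
          have "(\<Sum>i\<in>{1..k}. x0 (2 * n + i)) = of_real (sqrt k)"
          proof -
            have "(\<Sum>i\<in>{1..k}. x0 (2 * n + i)) = (\<Sum>i\<in>{1..k}. complex_of_real (1 / sqrt k))"
              by (rule sum.cong) (auto simp: x0_def)
            also have "\<dots> = of_real (real k * (1 / sqrt k))"
              by (simp only: sum_constant card_atLeastAtMost of_real_mult of_real_of_nat_eq) simp
            also have "real k * (1 / sqrt k) = sqrt k" using k1 by (simp add: real_div_sqrt)
            finally show ?thesis .
          qed
          then show "(cmod (\<Sum>i\<in>{1..N}. m (2 * n + l) i * x0 i))\<^sup>2 = (if l = 1 then real k else 0)"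
            unfolding N_def m_def padded_row(3)[OF l] by simp
        qed
        ultimately show ?thesis using k1 unfolding N_def sum_three_blocks[of _ n k] by simp
      qed
      finally show "ell2_norm {1..N} (T x0) = sqrt k" by (metis ell2_norm_nonneg real_sqrt_unique)
    qed (use T in auto)
    have "ell2_norm {1..N} (T (ell2_basis i)) = 1" if i: "i \<in> {1..N}" for i
    proof -
      have "(ell2_norm {1..N} (T (ell2_basis i)))\<^sup>2 = (\<Sum>j\<in>{1..N}. (cmod (m j i))\<^sup>2)"
        unfolding ell2_norm_sq_finite[OF finite_atLeastAtMost] T_def by (simp add: matrix_oper_basis[OF i])
      also have "\<dots> = 1" unfolding N_def m_def
        by (rule padded_column) (use col i in \<open>auto simp: N_def\<close>)
      finally show ?thesis by (metis abs_of_nonneg abs_square_eq_1 ell2_norm_nonneg)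
    qed
    then have "\<forall>i\<in>{1..N}. ell2_norm {1..N} (T (ell2_basis i)) = 1" by blast
    then have "column_partition N T D ?R"
      using P T(1) norm unfolding partition_property_def by metis
    then obtain A :: "nat \<Rightarrow> nat set" where A0: "disjoint_family_on A {1..?R} \<and> (\<Union>j\<in>{1..?R}. A j) = {1..N} \<and>
      (\<forall>j\<in>{1..?R}. \<forall>a. (ell2_norm {1..N} (\<lambda>k. \<Sum>i\<in>A j. a i * T (ell2_basis i) k))\<^sup>2 \<le> D * (\<Sum>i\<in>A j. (cmod (a i))\<^sup>2))"
      unfolding column_partition_def ..
    note A = A0[THEN conjunct2, THEN conjunct1]
      and AD = A0[THEN conjunct2, THEN conjunct2, rule_format]
    define c where "c i = (SOME j. j \<in> {1..?R} \<and> i \<in> A j)" for i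
    have c: "c i \<in> {1..?R} \<and> i \<in> A (c i)" if "i \<in> {1..N}" for i
      unfolding c_def by (rule someI_ex) (use A that in blast)
    have nN: "{1..n} \<subseteq> {1..N}" by (auto simp: N_def)
    show "\<exists>c::nat \<Rightarrow> nat. (\<forall>i\<in>{1..n}. c i \<in> {1..?R}) \<and>
        (\<forall>l x. (\<forall>i. x i \<noteq> 0 \<longrightarrow> c i = l) \<longrightarrow>
          (\<Sum>j\<in>{1..n}. (cmod (\<Sum>i\<in>{1..n}. s j i * x i))\<^sup>2) \<le> D * (\<Sum>i\<in>{1..n}. (cmod (x i))\<^sup>2))"
    proof (intro exI[of _ c] conjI ballI allI impI)
      show "c i \<in> {1..?R}" if "i \<in> {1..n}" for i using c that nN by blast
      fix l and x :: "nat \<Rightarrow> complex" assume xl: "\<forall>i. x i \<noteq> 0 \<longrightarrow> c i = l"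
      show "(\<Sum>j\<in>{1..n}. (cmod (\<Sum>i\<in>{1..n}. s j i * x i))\<^sup>2) \<le> D * (\<Sum>i\<in>{1..n}. (cmod (x i))\<^sup>2)"
      proof (cases "\<exists>i\<in>{1..n}. x i \<noteq> 0")
        case True
        then have l: "l \<in> {1..?R}" using c xl nN by blast
        define a where "a i = (if i \<in> {1..n} then x i else 0)" for i
        have AlN: "A l \<subseteq> {1..N}" using A l by blast
        then have fin: "finite (A l)" using finite_subset by blast
        have supp: "a i = 0" if "i \<notin> A l" for i using that c xl nN unfolding a_def by auto
        have sub: "(\<Sum>i\<in>A l. F i) = (\<Sum>i\<in>{1..n}. F i)" if "\<And>i. a i = 0 \<Longrightarrow> F i = 0" for F :: "nat \<Rightarrow> 'z::comm_monoid_add"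
          by (rule sum.mono_neutral_cong) (use that supp fin in \<open>auto simp: a_def\<close>)
        have "(\<Sum>j\<in>{1..n}. (cmod (\<Sum>i\<in>{1..n}. s j i * x i))\<^sup>2)
          = (\<Sum>j\<in>{1..n}. (cmod (\<Sum>i\<in>A l. a i * T (ell2_basis i) j))\<^sup>2)"
        proof (rule sum.cong[OF refl])
          fix j assume j: "j \<in> {1..n}"
          have "(\<Sum>i\<in>A l. a i * T (ell2_basis i) j) = (\<Sum>i\<in>{1..n}. a i * T (ell2_basis i) j)"
            by (rule sub) simp
          also have "\<dots> = (\<Sum>i\<in>{1..n}. s j i * x i)"
          proof (rule sum.cong[OF refl])
            fix i assume i: "i \<in> {1..n}"
            then have "T (ell2_basis i) j = m j i"
              unfolding T_def using j nN by (subst matrix_oper_basis) auto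
            then show "a i * T (ell2_basis i) j = s j i * x i" using i j by (simp add: m_def padded_def a_def)
          qed
          finally show "(cmod (\<Sum>i\<in>{1..n}. s j i * x i))\<^sup>2 = (cmod (\<Sum>i\<in>A l. a i * T (ell2_basis i) j))\<^sup>2" by simp
        qed
        also have "\<dots> \<le> (\<Sum>j\<in>{1..N}. (cmod (\<Sum>i\<in>A l. a i * T (ell2_basis i) j))\<^sup>2)"
          by (rule sum_mono2) (use nN in auto)
        also have "\<dots> \<le> D * (\<Sum>i\<in>A l. (cmod (a i))\<^sup>2)"
          using AD[OF l, of a] by (simp add: ell2_norm_sq_finite)
        also have "(\<Sum>i\<in>A l. (cmod (a i))\<^sup>2) = (\<Sum>i\<in>{1..n}. (cmod (a i))\<^sup>2)" by (rule sub) simp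
        also have "\<dots> = (\<Sum>i\<in>{1..n}. (cmod (x i))\<^sup>2)" by (simp add: a_def)
        finally show ?thesis .
      qed simp
    qed
  qed
qed

text \<open>
  Take a colouring that minimises the total weight inside the colour classes. Recolouring a vertex \<open>i\<close> cannot
  lower the cost, so its current colour carries the least weight seen from \<open>i\<close> among the \<open>s\<close> colours, hence at most
  the average.
\<close>

lemma balanced_colouring:
  fixes w :: "'v \<Rightarrow> 'v \<Rightarrow> real" and s :: nat
  assumes V: "finite V" and s: "0 < s" and sym: "\<And>i j. w i j = w j i"
  shows "\<exists>c. (\<forall>i\<in>V. c i < s) \<and>
    (\<forall>i\<in>V. real s * (\<Sum>j | j \<in> V - {i} \<and> c j = c i. w i j) \<le> (\<Sum>j\<in>V - {i}. w i j))"
proof -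
  define cost where "cost c = (\<Sum>i\<in>V. \<Sum>j\<in>V - {i}. if c i = c j then w i j else 0)" for c :: "'v \<Rightarrow> nat"
  define X where "X = (V \<rightarrow>\<^sub>E {..<s})"
  have "finite X" "X \<noteq> {}" using V s by (auto simp: X_def finite_PiE PiE_eq_empty_iff)
  then obtain c where c: "c \<in> X" "\<And>c'. c' \<in> X \<Longrightarrow> cost c \<le> cost c'"
    using ex_is_arg_min_if_finite[of X cost] by (auto simp: is_arg_min_linorder)
  have "real s * (\<Sum>j | j \<in> V - {i} \<and> c j = c i. w i j) \<le> (\<Sum>j\<in>V - {i}. w i j)" if i: "i \<in> V" for i
  proof -
    let ?load = "\<lambda>l. \<Sum>j\<in>V - {i}. if l = c j then w i j else 0"
    define rest where "rest = (\<Sum>i'\<in>V - {i}. \<Sum>j\<in>V - {i'} - {i}. if c i' = c j then w i' j else 0)"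
    have cost: "cost (c(i := l)) = 2 * ?load l + rest" for l
    proof -
      have "cost (c(i := l)) = (\<Sum>j\<in>V - {i}. if l = c j then w i j else 0)
        + (\<Sum>i'\<in>V - {i}. \<Sum>j\<in>V - {i'}. if (c(i := l)) i' = (c(i := l)) j then w i' j else 0)"
        unfolding cost_def by (subst sum.remove[OF V i]) (auto intro!: sum.cong)
      also have "(\<Sum>i'\<in>V - {i}. \<Sum>j\<in>V - {i'}. if (c(i := l)) i' = (c(i := l)) j then w i' j else 0)
        = (\<Sum>i'\<in>V - {i}. (if l = c i' then w i i' else 0) + (\<Sum>j\<in>V - {i'} - {i}. if c i' = c j then w i' j else 0))"
      proof (rule sum.cong[OF refl])
        fix i' assume i': "i' \<in> V - {i}"
        show "(\<Sum>j\<in>V - {i'}. if (c(i := l)) i' = (c(i := l)) j then w i' j else 0)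
          = (if l = c i' then w i i' else 0) + (\<Sum>j\<in>V - {i'} - {i}. if c i' = c j then w i' j else 0)"
          using i i' V by (subst sum.remove[of _ i]) (auto simp: sym intro!: sum.cong)
      qed
      also have "(\<Sum>j\<in>V - {i}. if l = c j then w i j else 0) + \<dots> = 2 * ?load l + rest"
        by (simp add: sum.distrib rest_def)
      finally show ?thesis .
    qed
    have le: "?load (c i) \<le> ?load l" if "l < s" for l
    proof -
      have "c(i := l) \<in> X" using c(1) i that by (auto simp: X_def PiE_def extensional_def)
      then have "cost (c(i := c i)) \<le> cost (c(i := l))" using c(2) by simp
      then show ?thesis unfolding cost by simp
    qed
    have "(\<Sum>l<s. ?load (c i)) \<le> (\<Sum>l<s. ?load l)" by (rule sum_mono, rule le) simp
    also have "\<dots> = (\<Sum>j\<in>V - {i}. \<Sum>l<s. if l = c j then w i j else 0)" by (rule sum.swap)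
    also have "\<dots> = (\<Sum>j\<in>V - {i}. w i j)"
      using c(1) by (intro sum.cong) (auto simp: X_def PiE_def Pi_def)
    also have "?load (c i) = (\<Sum>j | j \<in> V - {i} \<and> c j = c i. w i j)"
      using V by (subst sum.inter_filter[symmetric]) (auto intro!: sum.cong)
    finally show ?thesis by simp
  qed
  then show ?thesis using c(1) by (auto simp: X_def)
qed

text \<open>
  The same statement indexed from 0, to match the coordinates of sequences over the naturals.
\<close>

lemma partition_columns_shift:
  assumes P: "partition_property D r" and M: "0 \<le> M"
  shows "\<exists>R::nat. \<forall>n s. (\<forall>x. (\<Sum>j<n. (cmod (\<Sum>i<n. s j i * x i))\<^sup>2) \<le> M * (\<Sum>i<n. (cmod (x i))\<^sup>2)) \<longrightarrow>
      (\<forall>i<n. (\<Sum>j<n. (cmod (s j i))\<^sup>2) \<le> 1) \<longrightarrow>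
      (\<exists>c::nat \<Rightarrow> nat. (\<forall>i<n. c i \<in> {1..R}) \<and>
        (\<forall>l x. (\<forall>i. x i \<noteq> 0 \<longrightarrow> c i = l) \<longrightarrow>
          (\<Sum>j<n. (cmod (\<Sum>i<n. s j i * x i))\<^sup>2) \<le> D * (\<Sum>i<n. (cmod (x i))\<^sup>2)))"
proof -
  obtain R where R: "\<And>n s. (\<forall>x. (\<Sum>j\<in>{1..n}. (cmod (\<Sum>i\<in>{1..n}. s j i * x i))\<^sup>2) \<le> M * (\<Sum>i\<in>{1..n}. (cmod (x i))\<^sup>2)) \<Longrightarrow>
      (\<forall>i\<in>{1..n}. (\<Sum>j\<in>{1..n}. (cmod (s j i))\<^sup>2) \<le> 1) \<Longrightarrow>
      (\<exists>c::nat \<Rightarrow> nat. (\<forall>i\<in>{1..n}. c i \<in> {1..R}) \<and>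
        (\<forall>l x. (\<forall>i. x i \<noteq> 0 \<longrightarrow> c i = l) \<longrightarrow>
          (\<Sum>j\<in>{1..n}. (cmod (\<Sum>i\<in>{1..n}. s j i * x i))\<^sup>2) \<le> D * (\<Sum>i\<in>{1..n}. (cmod (x i))\<^sup>2)))"
    using partition_columns[OF P M] by blast
  have sh: "(\<Sum>i\<in>{1..n}. f i) = (\<Sum>i<n. f (Suc i))" for f :: "nat \<Rightarrow> 'z::comm_monoid_add" and n
    by (simp add: sum.atLeast1_atMost_eq)
  show ?thesis
  proof (intro exI[of _ R] allI impI)
    fix n and s :: "nat \<Rightarrow> nat \<Rightarrow> complex"
    assume bd: "\<forall>x. (\<Sum>j<n. (cmod (\<Sum>i<n. s j i * x i))\<^sup>2) \<le> M * (\<Sum>i<n. (cmod (x i))\<^sup>2)"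
      and col: "\<forall>i<n. (\<Sum>j<n. (cmod (s j i))\<^sup>2) \<le> 1"
    define s' where "s' j i = s (j - 1) (i - 1)" for j i
    have "\<forall>x. (\<Sum>j\<in>{1..n}. (cmod (\<Sum>i\<in>{1..n}. s' j i * x i))\<^sup>2) \<le> M * (\<Sum>i\<in>{1..n}. (cmod (x i))\<^sup>2)"
    proof
      fix x
      show "(\<Sum>j\<in>{1..n}. (cmod (\<Sum>i\<in>{1..n}. s' j i * x i))\<^sup>2) \<le> M * (\<Sum>i\<in>{1..n}. (cmod (x i))\<^sup>2)"
        unfolding sh using bd[rule_format, of "\<lambda>i. x (Suc i)"] by (simp add: s'_def)
    qed
    moreover have "\<forall>i\<in>{1..n}. (\<Sum>j\<in>{1..n}. (cmod (s' j i))\<^sup>2) \<le> 1"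
    proof
      fix i assume "i \<in> {1..n}"
      then have "i - 1 < n" by auto
      then show "(\<Sum>j\<in>{1..n}. (cmod (s' j i))\<^sup>2) \<le> 1" unfolding sh using col by (simp add: s'_def)
    qed
    ultimately obtain c :: "nat \<Rightarrow> nat" where c: "\<forall>i\<in>{1..n}. c i \<in> {1..R}"
      and cD: "\<And>l x. (\<forall>i. x i \<noteq> 0 \<longrightarrow> c i = l) \<Longrightarrow>
          (\<Sum>j\<in>{1..n}. (cmod (\<Sum>i\<in>{1..n}. s' j i * x i))\<^sup>2) \<le> D * (\<Sum>i\<in>{1..n}. (cmod (x i))\<^sup>2)"
      using R[where n = n and s = s'] by blast
    show "\<exists>c::nat \<Rightarrow> nat. (\<forall>i<n. c i \<in> {1..R}) \<and>
        (\<forall>l x. (\<forall>i. x i \<noteq> 0 \<longrightarrow> c i = l) \<longrightarrow>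
          (\<Sum>j<n. (cmod (\<Sum>i<n. s j i * x i))\<^sup>2) \<le> D * (\<Sum>i<n. (cmod (x i))\<^sup>2))"
    proof (intro exI[of _ "\<lambda>i. c (Suc i)"] conjI allI impI)
      show "c (Suc i) \<in> {1..R}" if "i < n" for i using c that by auto
      fix l and x :: "nat \<Rightarrow> complex" assume x: "\<forall>i. x i \<noteq> 0 \<longrightarrow> c (Suc i) = l"
      define y where "y i = (case i of 0 \<Rightarrow> 0 | Suc k \<Rightarrow> x k)" for i
      have "\<forall>i. y i \<noteq> 0 \<longrightarrow> c i = l" using x by (auto simp: y_def split: nat.splits)
      from cD[OF this] show "(\<Sum>j<n. (cmod (\<Sum>i<n. s j i * x i))\<^sup>2) \<le> D * (\<Sum>i<n. (cmod (x i))\<^sup>2)"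
        unfolding sh by (simp add: s'_def y_def)
    qed
  qed
qed

lemma oper_finite_support_apply:
  assumes T: "T \<in> bounded_opers UNIV" and F: "finite F" and x: "\<And>i. i \<notin> F \<Longrightarrow> x i = 0"
  shows "T x j = (\<Sum>i\<in>F. T (ell2_basis i) j * x i)"
proof -
  have "clip F x = x" using x by (auto simp: clip_def)
  then have "T x j = ell2_inner UNIV (T (clip F x)) (ell2_basis j)" by (simp add: inner_basis_right)
  also have "\<dots> = (\<Sum>i\<in>F. T (ell2_basis i) j * x i)"
    unfolding oper_clip_finite[OF T basis_ell2 F] by (simp add: inner_basis_right mult.commute)
  finally show ?thesis .
qed

text \<open>
  The first colouring \<open>a\<close> makes the columns within each class short, the second colouring \<open>b p\<close> splits the class
  \<open>p\<close> so that short columns give a small norm. The set of colour pairs is chosen before the dimension \<open>n\<close>, as the passage to the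
  limit requires.
\<close>

lemma finite_paving:
  fixes H :: "nat oper"
  assumes P: "partition_property D r" and D: "1 \<le> D" and H: "hermitian H"
    and diag0: "\<And>k. H (ell2_basis k) k = 0" and \<eta>: "0 < \<eta>"
  shows "\<exists>C::(nat \<times> nat) set. finite C \<and> (\<forall>n. \<exists>c. (\<forall>i. c i \<in> C) \<and>
    (\<forall>l x. (\<forall>i. x i \<noteq> 0 \<longrightarrow> i < n \<and> c i = l) \<longrightarrow> cmod (ell2_inner UNIV (H x) x) \<le> \<eta> * sqn x))"
proof -
  have Hb: "H \<in> bounded_opers UNIV" using H by (simp add: hermitian_def)
  obtain K where K: "0 \<le> K" "\<And>x. x \<in> ell2 UNIV \<Longrightarrow> ell2_norm UNIV (H x) \<le> K * ell2_norm UNIV x"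
    using oper_bounded[OF Hb] by blast
  define h where "h j i = H (ell2_basis i) j" for j i
  have hsym: "(cmod (h j i))\<^sup>2 = (cmod (h i j))\<^sup>2" for i j
  proof -
    have "h j i = ell2_inner UNIV (H (ell2_basis i)) (ell2_basis j)" by (simp add: h_def inner_basis_right)
    also have "\<dots> = ell2_inner UNIV (ell2_basis i) (H (ell2_basis j))"
      using H by (simp add: hermitian_def basis_ell2)
    also have "\<dots> = cnj (h i j)" by (subst inner_commute) (simp add: h_def inner_basis_right)
    finally show ?thesis by simp
  qed
  have colK: "(\<Sum>j\<in>F. (cmod (h j i))\<^sup>2) \<le> K\<^sup>2" if "finite F" for F i
  proof -
    have "(\<Sum>j\<in>F. (cmod (h j i))\<^sup>2) \<le> sqn (H (ell2_basis i))"
      unfolding h_def by (rule ell2_finite_sum_le[OF oper_in[OF Hb basis_ell2] that])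
    also have "\<dots> \<le> K\<^sup>2" using K(2)[OF basis_ell2, of i] by (intro power_mono) (auto simp: basis_norm)
    finally show ?thesis .
  qed
  \<comment> \<open>the column norm for which the final bound \<open>\<epsilon> sqrt D\<close> equals \<open>\<eta>\<close>\<close>
  define \<epsilon> where "\<epsilon> = \<eta> / sqrt D"
  have \<epsilon>: "0 < \<epsilon>" "D * \<epsilon>\<^sup>2 = \<eta>\<^sup>2" using D \<eta> by (auto simp: \<epsilon>_def power_divide)
  define s where "s = nat \<lceil>K\<^sup>2 / \<epsilon>\<^sup>2\<rceil> + 1"
  have s: "0 < s" "K\<^sup>2 \<le> real s * \<epsilon>\<^sup>2"
  proof -
    have "K\<^sup>2 / \<epsilon>\<^sup>2 \<le> real s" unfolding s_def by linarith
    then show "K\<^sup>2 \<le> real s * \<epsilon>\<^sup>2" using \<epsilon>(1) by (simp add: field_simps)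
  qed (simp add: s_def)
  have M: "0 \<le> K\<^sup>2 / \<epsilon>\<^sup>2" by simp
  obtain R where R: "\<And>n s. (\<forall>x. (\<Sum>j<n. (cmod (\<Sum>i<n. s j i * x i))\<^sup>2) \<le> K\<^sup>2 / \<epsilon>\<^sup>2 * (\<Sum>i<n. (cmod (x i))\<^sup>2)) \<Longrightarrow>
      (\<forall>i<n. (\<Sum>j<n. (cmod (s j i))\<^sup>2) \<le> 1) \<Longrightarrow>
      (\<exists>c::nat \<Rightarrow> nat. (\<forall>i<n. c i \<in> {1..R}) \<and>
        (\<forall>l x. (\<forall>i. x i \<noteq> 0 \<longrightarrow> c i = l) \<longrightarrow>
          (\<Sum>j<n. (cmod (\<Sum>i<n. s j i * x i))\<^sup>2) \<le> D * (\<Sum>i<n. (cmod (x i))\<^sup>2)))"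
    using partition_columns_shift[OF P M] by blast
  show ?thesis
  proof (intro exI[of _ "{..<s} \<times> {0..R}"] conjI allI)
    fix n
    obtain a where a: "\<And>i. i < n \<Longrightarrow> a i < s"
      and bal: "\<And>i. i < n \<Longrightarrow> real s * (\<Sum>j | j \<in> {..<n} - {i} \<and> a j = a i. (cmod (h i j))\<^sup>2) \<le> (\<Sum>j\<in>{..<n} - {i}. (cmod (h i j))\<^sup>2)"
      using balanced_colouring[of "{..<n}" s "\<lambda>i j. (cmod (h i j))\<^sup>2", OF _ s(1) hsym] by auto
    have small: "(\<Sum>j | j < n \<and> a j = a i. (cmod (h j i))\<^sup>2) \<le> \<epsilon>\<^sup>2" if i: "i < n" for i
    proof -
      have "(\<Sum>j | j < n \<and> a j = a i. (cmod (h j i))\<^sup>2) = (\<Sum>j | j \<in> {..<n} - {i} \<and> a j = a i. (cmod (h i j))\<^sup>2)"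
      proof (rule sum.mono_neutral_cong_right)
        show "(cmod (h j i))\<^sup>2 = (cmod (h i j))\<^sup>2" for j by (rule hsym)
      qed (auto simp: h_def diag0)
      then have "real s * (\<Sum>j | j < n \<and> a j = a i. (cmod (h j i))\<^sup>2)
          = real s * (\<Sum>j | j \<in> {..<n} - {i} \<and> a j = a i. (cmod (h i j))\<^sup>2)" by simp
      also have "\<dots> \<le> K\<^sup>2"
      proof -
        have "(\<Sum>j\<in>{..<n} - {i}. (cmod (h i j))\<^sup>2) = (\<Sum>j\<in>{..<n} - {i}. (cmod (h j i))\<^sup>2)"
          by (rule sum.cong[OF refl hsym])
        then show ?thesis using bal[OF i] colK[of "{..<n} - {i}" i] by simp
      qed
      finally have "real s * (\<Sum>j | j < n \<and> a j = a i. (cmod (h j i))\<^sup>2) \<le> real s * \<epsilon>\<^sup>2" using s(2) by linarith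
      then show ?thesis using s(1) by (simp add: mult_le_cancel_left_pos)
    qed
    \<comment> \<open>the compression of \<open>H\<close> to class \<open>l\<close>, rescaled to columns of norm at most 1\<close>
    define S where "S l j i = (if a j = l \<and> a i = l then h j i / of_real \<epsilon> else 0)" for l j i
    have Srow: "(\<Sum>i<n. S l j i * x i) = (if a j = l then H (clip {i. i < n \<and> a i = l} x) j / of_real \<epsilon> else 0)" for l j x
    proof (cases "a j = l")
      case True
      have "H (clip {i. i < n \<and> a i = l} x) j = (\<Sum>i<n. h j i * clip {i. i < n \<and> a i = l} x i)"
        unfolding h_def by (rule oper_finite_support_apply[OF Hb]) (auto simp: clip_def)
      then have "H (clip {i. i < n \<and> a i = l} x) j / of_real \<epsilon>
        = (\<Sum>i<n. h j i * clip {i. i < n \<and> a i = l} x i / of_real \<epsilon>)" by (simp add: sum_divide_distrib)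
      also have "\<dots> = (\<Sum>i<n. S l j i * x i)" using True by (intro sum.cong) (auto simp: S_def clip_def)
      finally show ?thesis using True by simp
    qed (simp add: S_def)
    have "\<exists>c::nat \<Rightarrow> nat. (\<forall>i<n. c i \<in> {1..R}) \<and>
        (\<forall>l' x. (\<forall>i. x i \<noteq> 0 \<longrightarrow> c i = l') \<longrightarrow>
          (\<Sum>j<n. (cmod (\<Sum>i<n. S l j i * x i))\<^sup>2) \<le> D * (\<Sum>i<n. (cmod (x i))\<^sup>2))" for l
    proof (rule R)
      show "\<forall>i<n. (\<Sum>j<n. (cmod (S l j i))\<^sup>2) \<le> 1"
      proof (intro allI impI)
        fix i assume i: "i < n"
        have "(\<Sum>j<n. (cmod (S l j i))\<^sup>2) \<le> (\<Sum>j<n. if a j = a i then (cmod (h j i))\<^sup>2 / \<epsilon>\<^sup>2 else 0)"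
          using \<epsilon>(1) by (intro sum_mono) (auto simp: S_def norm_divide power_divide)
        also have "\<dots> = (\<Sum>j | j < n \<and> a j = a i. (cmod (h j i))\<^sup>2) / \<epsilon>\<^sup>2"
          by (subst sum_divide_distrib, rule sum.mono_neutral_cong_right) auto
        also have "\<dots> \<le> 1" using small[OF i] \<epsilon>(1) by simp
        finally show "(\<Sum>j<n. (cmod (S l j i))\<^sup>2) \<le> 1" .
      qed
      show "\<forall>x. (\<Sum>j<n. (cmod (\<Sum>i<n. S l j i * x i))\<^sup>2) \<le> K\<^sup>2 / \<epsilon>\<^sup>2 * (\<Sum>i<n. (cmod (x i))\<^sup>2)"
      proof
        fix x
        define y where "y = clip {i. i < n \<and> a i = l} x"
        have y: "y \<in> ell2 UNIV"
          by (rule finite_support_ell2, rule finite_subset[of _ "{..<n}"]) (auto simp: y_def clip_def)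
        have "(\<Sum>j<n. (cmod (\<Sum>i<n. S l j i * x i))\<^sup>2) \<le> (\<Sum>j<n. (cmod (H y j))\<^sup>2 / \<epsilon>\<^sup>2)"
          unfolding Srow y_def[symmetric] using \<epsilon>(1)
          by (intro sum_mono) (auto simp: norm_divide power_divide)
        also have "\<dots> \<le> sqn (H y) / \<epsilon>\<^sup>2"
          unfolding sum_divide_distrib[symmetric]
          by (intro divide_right_mono ell2_finite_sum_le oper_in[OF Hb y]) auto
        also have "\<dots> \<le> (K * ell2_norm UNIV y)\<^sup>2 / \<epsilon>\<^sup>2"
          by (intro divide_right_mono power_mono K(2) y) auto
        also have "\<dots> = K\<^sup>2 / \<epsilon>\<^sup>2 * (\<Sum>i<n. (cmod (y i))\<^sup>2)"
          by (subst finite_support_sqn[of "{..<n}", symmetric]) (auto simp: y_def clip_def power_mult_distrib)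
        also have "\<dots> \<le> K\<^sup>2 / \<epsilon>\<^sup>2 * (\<Sum>i<n. (cmod (x i))\<^sup>2)"
          by (intro mult_left_mono sum_mono M) (auto simp: y_def clip_def)
        finally show "(\<Sum>j<n. (cmod (\<Sum>i<n. S l j i * x i))\<^sup>2) \<le> K\<^sup>2 / \<epsilon>\<^sup>2 * (\<Sum>i<n. (cmod (x i))\<^sup>2)" .
      qed
    qed
    from choice[OF allI, OF this] obtain b :: "nat \<Rightarrow> nat \<Rightarrow> nat"
      where b0: "\<forall>l. (\<forall>i<n. b l i \<in> {1..R}) \<and>
        (\<forall>l' x. (\<forall>i. x i \<noteq> 0 \<longrightarrow> b l i = l') \<longrightarrow>
          (\<Sum>j<n. (cmod (\<Sum>i<n. S l j i * x i))\<^sup>2) \<le> D * (\<Sum>i<n. (cmod (x i))\<^sup>2))" ..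
    have b: "b l i \<in> {1..R}" if "i < n" for l i
      using b0[THEN spec, THEN conjunct1] that by blast
    have bD: "(\<Sum>j<n. (cmod (\<Sum>i<n. S l j i * x i))\<^sup>2) \<le> D * (\<Sum>i<n. (cmod (x i))\<^sup>2)"
      if "\<forall>i. x i \<noteq> 0 \<longrightarrow> b l i = l'" for l l' x
      by (rule b0[THEN spec, THEN conjunct2, THEN spec, THEN spec, THEN mp, OF that])
    define c where "c i = (if i < n then (a i, b (a i) i) else (0, 0))" for i
    show "\<exists>c. (\<forall>i. c i \<in> {..<s} \<times> {0..R}) \<and>
      (\<forall>l x. (\<forall>i. x i \<noteq> 0 \<longrightarrow> i < n \<and> c i = l) \<longrightarrow> cmod (ell2_inner UNIV (H x) x) \<le> \<eta> * sqn x)"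
    proof (intro exI[of _ c] conjI allI impI)
      show "c i \<in> {..<s} \<times> {0..R}" for i using a b[of i "a i"] s(1) by (auto simp: c_def)
      fix l :: "nat \<times> nat" and x :: "nat \<Rightarrow> complex" assume x: "\<forall>i. x i \<noteq> 0 \<longrightarrow> i < n \<and> c i = l"
      obtain p q where l: "l = (p, q)" by fastforce
      have xp: "i < n \<and> a i = p \<and> b p i = q" if "x i \<noteq> 0" for i
        using x that by (auto simp: c_def l split: if_splits)
      define B where "B = {i. i < n \<and> a i = p}"
      have "clip B x i = x i" for i using xp[of i] by (cases "x i = 0") (auto simp: clip_def B_def)
      then have xB: "clip B x = x" by blast
      have supp: "x i = 0" if "i \<notin> {..<n}" for i using xp that by auto
      have xin: "x \<in> ell2 UNIV"
        by (rule finite_support_ell2, rule finite_subset[of _ "{..<n}"]) (use supp in auto)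
      have sqx: "sqn x = (\<Sum>i<n. (cmod (x i))\<^sup>2)" by (rule finite_support_sqn) (use supp in auto)
      have "sqn (clip B (H x)) = (\<Sum>j<n. (cmod (clip B (H x) j))\<^sup>2)"
        by (rule finite_support_sqn) (auto simp: clip_def B_def)
      also have "\<dots> = (\<Sum>j<n. \<epsilon>\<^sup>2 * (cmod (\<Sum>i<n. S p j i * x i))\<^sup>2)"
        unfolding Srow B_def[symmetric] xB
        by (rule sum.cong) (use \<epsilon>(1) in \<open>auto simp: clip_def B_def norm_divide power_divide\<close>)
      also have "\<dots> \<le> \<epsilon>\<^sup>2 * (D * sqn x)"
        unfolding sum_distrib_left[symmetric] sqx by (intro mult_left_mono bD[of x p q]) (use xp in auto)
      also have "\<dots> = (\<eta> * ell2_norm UNIV x)\<^sup>2" using \<epsilon>(2) by (simp add: power_mult_distrib algebra_simps)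
      finally have n: "ell2_norm UNIV (clip B (H x)) \<le> \<eta> * ell2_norm UNIV x"
        by (rule power2_le_imp_le) (use \<eta> in auto)
      have "ell2_inner UNIV (H x) x = ell2_inner UNIV (clip B (H x)) x"
        unfolding ell2_inner_def by (rule infsum_cong) (use xp in \<open>auto simp: clip_def B_def\<close>)
      also have "cmod \<dots> \<le> ell2_norm UNIV (clip B (H x)) * ell2_norm UNIV x"
        by (rule inner_product_summable(2)[OF clip_ell2[OF oper_in[OF Hb xin]] xin])
      also have "\<dots> \<le> \<eta> * ell2_norm UNIV x * ell2_norm UNIV x" by (intro mult_right_mono n) auto
      finally show "cmod (ell2_inner UNIV (H x) x) \<le> \<eta> * sqn x" by (simp add: power2_eq_square mult.assoc)
    qed
  qed simp
qed

text \<open>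
  Along an ultrafilter finer than \<open>n \<rightarrow> \<infinity>\<close> the colour of each index is eventually constant. Every finitely
  supported vector only sees finitely many of these choices, so it inherits the bound; general vectors follow by approximation.
\<close>

lemma infinite_paving:
  fixes H :: "nat oper"
  assumes P: "partition_property D r" and D: "1 \<le> D" and H: "hermitian H"
    and diag0: "\<And>k. H (ell2_basis k) k = 0" and \<eta>: "0 < \<eta>"
  shows "\<exists>(C::(nat \<times> nat) set) c. finite C \<and> (\<forall>i. c i \<in> C) \<and>
    (\<forall>l. \<forall>x\<in>ell2 UNIV. clip {i. c i = l} x = x \<longrightarrow> cmod (ell2_inner UNIV (H x) x) \<le> \<eta> * sqn x)"
proof -
  have Hb: "H \<in> bounded_opers UNIV" using H by (simp add: hermitian_def)
  obtain C :: "(nat \<times> nat) set" and c where C: "finite C" and c: "\<And>n i. c n i \<in> C"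
    and cn: "\<And>n l x. (\<forall>i. x i \<noteq> 0 \<longrightarrow> i < n \<and> c n i = l) \<Longrightarrow> cmod (ell2_inner UNIV (H x) x) \<le> \<eta> * sqn x"
    using finite_paving[OF assms] by metis
  obtain U where U: "U \<le> sequentially" "ultrafilter U" using ultrafilter_exists[OF sequentially_bot] by blast
  have "\<exists>l\<in>C. eventually (\<lambda>n. c n i = l) U" for i
    by (rule ultrafilter_finite_range[OF U(2) C]) (simp add: c)
  then obtain d where d: "\<And>i. d i \<in> C" "\<And>i. eventually (\<lambda>n. c n i = d i) U" by metis
  show ?thesis
  proof (intro exI[of _ C] exI[of _ d] conjI allI ballI impI)
    fix l and x :: "nat \<Rightarrow> complex" assume x: "x \<in> ell2 UNIV" and xl: "clip {i. d i = l} x = x"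
    have supp: "d i = l" if "x i \<noteq> 0" for i
      using fun_cong[OF xl, of i] that by (auto simp: clip_def split: if_splits)
    have fin: "cmod (ell2_inner UNIV (H (clip F x)) (clip F x)) \<le> \<eta> * sqn x" if F: "finite F" for F
    proof -
      have "eventually (\<lambda>n. \<forall>i\<in>F. c n i = d i) U" using d(2) F by (simp add: eventually_ball_finite_distrib)
      moreover have "eventually (\<lambda>n. \<forall>i\<in>F. i < n) U"
        by (rule filter_leD[OF U(1)]) (simp add: eventually_ball_finite_distrib[OF F] eventually_gt_at_top)
      ultimately have "eventually (\<lambda>n. \<forall>i\<in>F. i < n \<and> c n i = d i) U" by eventually_elim auto
      then obtain n where n: "\<forall>i\<in>F. i < n \<and> c n i = d i"
        using eventually_happens'[OF ultrafilterD(1)[OF U(2)]] by blast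
      have "cmod (ell2_inner UNIV (H (clip F x)) (clip F x)) \<le> \<eta> * sqn (clip F x)"
        by (rule cn[of _ n l]) (use n supp in \<open>auto simp: clip_def split: if_splits\<close>)
      also have "\<dots> \<le> \<eta> * sqn x"
        using \<eta> clip_norm_le[OF x, of F] by (intro mult_left_mono power_mono) auto
      finally show ?thesis .
    qed
    show "cmod (ell2_inner UNIV (H x) x) \<le> \<eta> * sqn x"
    proof (rule field_le_epsilon)
      fix e :: real assume e: "0 < e"
      define \<delta> where "\<delta> = e / (sqn x + 1)"
      have pos: "0 < sqn x + 1" by (simp add: add_nonneg_pos)
      then have \<delta>: "0 < \<delta>" "\<delta> * sqn x \<le> e" using e by (auto simp: \<delta>_def pos_divide_le_eq)
      obtain K where K: "\<And>F. cmod (ell2_inner UNIV (H x) x)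
        \<le> cmod (ell2_inner UNIV (H (clip F x)) (clip F x)) + \<delta> * sqn (clip F x) + K * sqn (clip (-F) x)"
        using form_block_bound[OF Hb \<delta>(1)] x by blast
      have lim: "((\<lambda>F. \<eta> * sqn x + e + K * sqn (clip (-F) x)) \<longlongrightarrow> \<eta> * sqn x + e + K * 0\<^sup>2) (finite_subsets_at_top UNIV)"
        by (intro tendsto_intros norm_clip_compl_tendsto x)
      have "cmod (ell2_inner UNIV (H x) x) \<le> \<eta> * sqn x + e + K * 0\<^sup>2"
      proof (rule tendsto_lowerbound[OF lim])
        show "eventually (\<lambda>F. cmod (ell2_inner UNIV (H x) x) \<le> \<eta> * sqn x + e + K * sqn (clip (-F) x)) (finite_subsets_at_top UNIV)"
        proof (rule eventually_finite_subsets_at_top_weakI)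
          fix F :: "nat set" assume F: "finite F"
          have "\<delta> * sqn (clip F x) \<le> \<delta> * sqn x"
            using \<delta>(1) clip_norm_le[OF x, of F] by (intro mult_left_mono power_mono) auto
          then show "cmod (ell2_inner UNIV (H x) x) \<le> \<eta> * sqn x + e + K * sqn (clip (-F) x)"
            using K[of F] fin[OF F] \<delta>(2) by linarith
        qed
      qed simp
      then show "cmod (ell2_inner UNIV (H x) x) \<le> \<eta> * sqn x + e" by simp
    qed
  qed (use C d in auto)
qed

text \<open>
  Paving makes every extension vanish on hermitian operators with zero diagonal, hence on \<open>T\<close> minus its diagonal part.
\<close>

lemma partition_imp_KS:
  assumes P: "partition_property D r" and D: "1 \<le> D"
  shows Kadison_Singer
  unfolding Kadison_Singer_def
proof
  let ?B = "bounded_opers UNIV :: nat oper set" and ?D = "diagonal_opers UNIV :: nat oper set"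
  fix f assume f: "f \<in> pure_states UNIV ?D"
  then have fs: "f \<in> states UNIV ?D" by (simp add: pure_states_def)
  note R = oper_space_bounded
  have zero: "g H = 0" if g: "g \<in> states UNIV ?B" "restrict g ?D = f" and H: "hermitian H" "\<And>k. H (ell2_basis k) k = 0" for g H
  proof -
    have Hb: "H \<in> ?B" using H(1) by (simp add: hermitian_def)
    have "cmod (g H) \<le> 0 + \<eta>" if \<eta>: "0 < \<eta>" for \<eta>
    proof -
      obtain C :: "(nat \<times> nat) set" and c where c: "finite C" "\<And>i. c i \<in> C"
        and small: "\<And>l x. x \<in> ell2 UNIV \<Longrightarrow> clip {i. c i = l} x = x \<Longrightarrow> cmod (ell2_inner UNIV (H x) x) \<le> \<eta> * sqn x"
        using infinite_paving[OF P D H \<eta>] by metis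
      obtain l where "f (proj {i. c i = l}) = 1" using pure_state_partition[where c = c, OF f c] by blast
      then have "g (proj {i. c i = l}) = 1" using g(2) proj_in by (metis restrict_apply')
      then have "cmod (g H) \<le> \<eta>" by (intro state_le_of_form_le_on[OF R g(1) Hb H(1) small])
      then show ?thesis by simp
    qed
    then have "cmod (g H) \<le> 0" by (rule field_le_epsilon)
    then show ?thesis by simp
  qed
  have determined: "g T = f (diag_part T)" if g: "g \<in> states UNIV ?B" "restrict g ?D = f" and T: "T \<in> ?B" for g T
  proof -
    have d: "diag_part T \<in> ?D" "diag_part T \<in> ?B" using diag_part_in[OF T] diagonal_subset_bounded by auto
    define Z where "Z = oper_lincomb UNIV 1 T (- 1) (diag_part T)"
    have Z: "Z \<in> ?B" unfolding Z_def by (rule lincomb_in[OF T d(2)])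
    have Z0: "Z (ell2_basis k) k = 0" for k
      by (simp add: Z_def lincomb_apply basis_ell2 diag_part_def diag_entry)
    have "re_part Z (ell2_basis k) k = 0" "im_part Z (ell2_basis k) k = 0" for k
      by (simp_all add: re_part_def im_part_def lincomb_apply basis_ell2 adj_entry[OF Z] Z0)
    then have "g (re_part Z) = 0" "g (im_part Z) = 0" using zero[OF g] parts_hermitian[OF Z] by auto
    then have "g Z = 0"
      using state_lincomb[OF g(1) parts_in[OF Z], of 1 \<i>] parts_sum[OF Z] by simp
    then have "g T = g (diag_part T)" using state_lincomb[OF g(1) T d(2), of 1 "- 1"] by (simp add: Z_def)
    then show ?thesis using g(2) d(1) by (metis restrict_apply')
  qed
  show "\<exists>!g. g \<in> states UNIV ?B \<and> restrict g ?D = f"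
  proof (rule ex1I[of _ "\<lambda>T\<in>?B. f (diag_part T)"])
    show "(\<lambda>T\<in>?B. f (diag_part T)) \<in> states UNIV ?B \<and> restrict (\<lambda>T\<in>?B. f (diag_part T)) ?D = f"
      using canonical_extension[OF fs] by auto
    fix g assume g: "g \<in> states UNIV ?B \<and> restrict g ?D = f"
    show "g = (\<lambda>T\<in>?B. f (diag_part T))"
    proof (rule extensionalityI)
      show "g \<in> extensional ?B" using g by (simp add: states_def)
    qed (use determined g in auto)
  qed
qed

section \<open>The equivalence\<close>

theorem theorem4p6:
  "Kadison_Singer \<longleftrightarrow>
   (\<exists>D::real. D \<ge> 1 \<and>
     (\<exists>r :: real \<Rightarrow> nat.
       \<forall>(n::nat). \<forall>T \<in> bounded_opers {1..n}.
         (\<forall>i\<in>{1..n}. ell2_norm {1..n} (T (ell2_basis i)) = 1) \<longrightarrow>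
         (\<exists>A :: nat \<Rightarrow> nat set.
            disjoint_family_on A {1..r (oper_norm {1..n} T)} \<and>
            (\<Union>j\<in>{1..r (oper_norm {1..n} T)}. A j) = {1..n} \<and>
            (\<forall>j\<in>{1..r (oper_norm {1..n} T)}. \<forall>a :: nat \<Rightarrow> complex.
               (ell2_norm {1..n} (\<lambda>k. \<Sum>i\<in>A j. a i * T (ell2_basis i) k))\<^sup>2
                 \<le> D * (\<Sum>i\<in>A j. (cmod (a i))\<^sup>2)))))"
proof -
  have "\<exists>r. partition_property 2 r" if KS: Kadison_Singer
  proof -
    have "\<forall>M. \<exists>R. \<forall>n. \<forall>T\<in>bounded_opers {1..n}.
        (\<forall>i\<in>{1..n}. ell2_norm {1..n} (T (ell2_basis i)) = 1) \<longrightarrow> oper_norm {1..n} T = M \<longrightarrow>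
        column_partition n T 2 R"
      by (intro allI KS_imp_partition KS)
    from choice[OF this] obtain r where r: "\<forall>M. \<forall>n. \<forall>T\<in>bounded_opers {1..n}.
        (\<forall>i\<in>{1..n}. ell2_norm {1..n} (T (ell2_basis i)) = 1) \<longrightarrow> oper_norm {1..n} T = M \<longrightarrow>
        column_partition n T 2 (r M)" ..
    have "partition_property 2 r"
      unfolding partition_property_def using r by simp
    then show ?thesis by blast
  qed
  moreover have "(1::real) \<le> 2" by simp
  ultimately have "Kadison_Singer \<longleftrightarrow> (\<exists>D\<ge>1. \<exists>r. partition_property D r)"
    using partition_imp_KS by blast
  then show ?thesis
    unfolding partition_property_def column_partition_def .
qed

end
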